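(* Let $f:\mathbb{R}\to\mathbb{R}$ be a nonnegative continuous function with $f(s)=f(0)$ for $s\le0$, having a monotone sequence $\{\alpha_n\}_{n\in\mathbb{N}}$ of positive zeros converging to some $\alpha\in(0,+\infty)$. Assume that for $\sigma=\alpha$ and for $\sigma=\alpha_n$, for every $n\in\mathbb{N}$, there exist $M>0$ and $\varepsilon>0$ (depending on $\sigma$) such that $s\mapsto f(s)+Ms$ is increasing on $(\sigma-\varepsilon,\sigma)$. For $n\in\mathbb{N}$ let $\Lambda_n$ be the set of all $\lambda\ge0$ for which the problem $$-\Delta u=\lambda f(u)\ \text{ in }\Omega,\qquad u=0\ \text{ on }\partial\Omega$$ has a solution $u\in H_0^1(\Omega)\cap L^\infty(\Omega)$ with $\min\{\alpha_n,\alpha_{n+1}\}<\|u\|_{L^\infty(\Omega)}<\max\{\alpha_n,\alpha_{n+1}\}$, and let $\lambda_n=\inf\Lambda_n$. Then the sequence $\{\lambda_n\}$ diverges, i.e. $\lambda_n\to+\infty$.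
   Context: $\Omega$ is a smooth open bounded subset of $\mathbb{R}^N$. Solutions are understood in the weak sense. The convention $\inf\emptyset=+\infty$ is used; the paper has in mind that $\alpha_n$ and $\alpha_{n+1}$ are consecutive zeros of $f$. *)

theory Defs
  imports "HOL-Probability.Essential_Supremum"
begin

text \<open>Smooth functions on an open set, by iterated Frechet derivatives.\<close>

fun Ck_on :: "nat \<Rightarrow> ('a::euclidean_space \<Rightarrow> real) \<Rightarrow> 'a set \<Rightarrow> bool" where
  "Ck_on 0 f S \<longleftrightarrow> continuous_on S f"
| "Ck_on (Suc k) f S \<longleftrightarrow>
     (\<forall>x\<in>S. f differentiable (at x)) \<and>
     (\<forall>v. Ck_on k (\<lambda>x. frechet_derivative f (at x) v) S)"

definition smooth_on :: "('a::euclidean_space \<Rightarrow> real) \<Rightarrow> 'a set \<Rightarrow> bool" where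
  "smooth_on f S \<longleftrightarrow> (\<forall>k. Ck_on k f S)"

text \<open>
  Near each boundary point, and in suitable orthonormal coordinates with last axis \<open>e\<close>,
  the set is the strict epigraph of a smooth function of the remaining coordinates.
  That function is given on the whole space and evaluated at the projection
  of the point onto the hyperplane orthogonal to \<open>e\<close>.
\<close>

definition smooth_boundary :: "'a::euclidean_space set \<Rightarrow> bool" where
  "smooth_boundary \<Omega> \<longleftrightarrow>
     (\<forall>p\<in>frontier \<Omega>. \<exists>r>0. \<exists>e. \<exists>\<gamma>. norm e = 1 \<and> smooth_on \<gamma> UNIV \<and>
        \<Omega> \<inter> ball p r = {x \<in> ball p r. \<gamma> (x - (x \<bullet> e) *\<^sub>R e) < x \<bullet> e})"

definition test_functions :: "'a::euclidean_space set \<Rightarrow> ('a \<Rightarrow> real) set" where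
  "test_functions \<Omega> =
     {\<phi>. smooth_on \<phi> UNIV \<and> compact (closure {x. \<phi> x \<noteq> 0}) \<and> closure {x. \<phi> x \<noteq> 0} \<subseteq> \<Omega>}"

text \<open>
  Elements of the Lebesgue and Sobolev spaces are represented by functions; no quotient
  by almost everywhere equality is taken. All notions below are invariant under changes on
  null sets.
\<close>

definition L2 :: "'a::euclidean_space set \<Rightarrow> ('a \<Rightarrow> 'b::euclidean_space) set" where
  "L2 \<Omega> = {u. u \<in> borel_measurable (lebesgue_on \<Omega>) \<and>
              integrable (lebesgue_on \<Omega>) (\<lambda>x. (norm (u x))\<^sup>2)}"

text \<open>With values in \<^typ>\<open>ennreal\<close>, the essential supremum over a null set is \<open>0\<close>.\<close>

definition Linf_norm :: "'a::euclidean_space set \<Rightarrow> ('a \<Rightarrow> real) \<Rightarrow> ennreal" where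
  "Linf_norm \<Omega> u = esssup (lebesgue_on \<Omega>) (\<lambda>x. ennreal \<bar>u x\<bar>)"

definition Linf :: "'a::euclidean_space set \<Rightarrow> ('a \<Rightarrow> real) set" where
  "Linf \<Omega> = {u. u \<in> borel_measurable (lebesgue_on \<Omega>) \<and> Linf_norm \<Omega> u < \<infinity>}"

definition has_weak_gradient ::
    "'a::euclidean_space set \<Rightarrow> ('a \<Rightarrow> real) \<Rightarrow> ('a \<Rightarrow> 'a) \<Rightarrow> bool" where
  "has_weak_gradient \<Omega> u g \<longleftrightarrow>
     (\<forall>\<phi>\<in>test_functions \<Omega>. \<forall>i\<in>Basis.
        (LINT x|lebesgue_on \<Omega>. u x * frechet_derivative \<phi> (at x) i) =
        - (LINT x|lebesgue_on \<Omega>. (g x \<bullet> i) * \<phi> x))"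

definition H1 :: "'a::euclidean_space set \<Rightarrow> ('a \<Rightarrow> real) set" where
  "H1 \<Omega> = {u \<in> L2 \<Omega>. \<exists>g\<in>L2 \<Omega>. has_weak_gradient \<Omega> u g}"

text \<open>Meaningful for \<open>u \<in> H1 \<Omega>\<close>, where it is unique up to null sets.\<close>

definition weak_gradient :: "'a::euclidean_space set \<Rightarrow> ('a \<Rightarrow> real) \<Rightarrow> 'a \<Rightarrow> 'a" where
  "weak_gradient \<Omega> u = (SOME g. g \<in> L2 \<Omega> \<and> has_weak_gradient \<Omega> u g)"

definition H1_norm :: "'a::euclidean_space set \<Rightarrow> ('a \<Rightarrow> real) \<Rightarrow> real" where
  "H1_norm \<Omega> u = sqrt ((LINT x|lebesgue_on \<Omega>. (u x)\<^sup>2) +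
                       (LINT x|lebesgue_on \<Omega>. (norm (weak_gradient \<Omega> u x))\<^sup>2))"

definition H10 :: "'a::euclidean_space set \<Rightarrow> ('a \<Rightarrow> real) set" where
  "H10 \<Omega> = {u \<in> H1 \<Omega>. \<exists>\<phi>. (\<forall>k::nat. \<phi> k \<in> test_functions \<Omega>) \<and>
              (\<lambda>k. H1_norm \<Omega> (\<lambda>x. u x - \<phi> k x)) \<longlonglongrightarrow> 0}"

text \<open>
  Bounded weak solutions of \<open>- \<Delta> u = lam * f u\<close> in \<open>\<Omega>\<close> with \<open>u = 0\<close> on the
  boundary; the boundary condition is membership in \<^const>\<open>H10\<close>. For bounded \<open>u\<close>, continuous
  \<open>f\<close> and bounded \<open>\<Omega>\<close>, both integrands are integrable.
\<close>

definition weak_solution ::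
    "'a::euclidean_space set \<Rightarrow> real \<Rightarrow> (real \<Rightarrow> real) \<Rightarrow> ('a \<Rightarrow> real) \<Rightarrow> bool" where
  "weak_solution \<Omega> lam f u \<longleftrightarrow> u \<in> H10 \<Omega> \<inter> Linf \<Omega> \<and>
     (\<forall>v\<in>H10 \<Omega>.
        (LINT x|lebesgue_on \<Omega>. weak_gradient \<Omega> u x \<bullet> weak_gradient \<Omega> v x) =
        lam * (LINT x|lebesgue_on \<Omega>. f (u x) * v x))"

definition Lambda_set :: "'a::euclidean_space set \<Rightarrow> (real \<Rightarrow> real) \<Rightarrow> real \<Rightarrow> real \<Rightarrow> real set" where
  "Lambda_set \<Omega> f a b = {lam. 0 \<le> lam \<and> (\<exists>u. weak_solution \<Omega> lam f u \<and>
     ennreal (min a b) < Linf_norm \<Omega> u \<and> Linf_norm \<Omega> u < ennreal (max a b))}"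

end

theory Submission
  imports Defs
begin

text \<open>
  The reason for the divergence is a bound that keeps solutions away from the level \<open>a\<close> as long as
  \<open>\<lambda>\<close> stays bounded. Since \<open>f\<close> is continuous with \<open>f a = 0\<close> and \<open>f s + M s\<close> increases just below
  \<open>a\<close>, there is a constant \<open>K\<close> with \<open>f s \<le> K (a - s)\<close> for all \<open>s \<le> a\<close>
  (\<open>linear_bound_left_of_zero\<close>). By continuity, for every \<open>\<tau> > 0\<close> the weaker bound
  \<open>f s \<le> K (a + \<tau> - s)\<close>, with the same \<open>K\<close>, persists slightly to the right of \<open>a\<close>
  (\<open>linear_bound_across_zero\<close>). This covers increasing and decreasing sequences of zeros alike.

  Hence a solution with \<open>\<lambda> \<le> C\<close> and norm close to \<open>a\<close> satisfies
  \<open>- \<Delta> u \<le> C K (A - u)\<close> with \<open>A = a + \<tau>\<close>. The function \<open>v = A - a \<psi>\<close>,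
  where \<open>\<psi> x = exp (- (x\<^sub>e - T)\<^sup>2)\<close> depends on one coordinate only and \<open>T\<close> is so large that
  \<open>\<Delta> \<psi> > C K \<psi>\<close> on the bounded set \<open>\<Omega>\<close>, is a strict supersolution of that linear problem, and
  it is nonnegative on the whole space. Comparison gives \<open>u \<le> v\<close>, and in the same
  way \<open>- u \<le> v\<close>. As \<open>\<psi>\<close> is bounded below on \<open>\<Omega>\<close>, this yields \<open>\<bar>u\<bar> \<le> a + \<tau> - d\<close> with some
  \<open>d > 0\<close> that depends neither on \<open>\<tau>\<close> nor on \<open>\<lambda> \<le> C\<close>
  (\<open>weak_solution_bound_below_zero_level\<close>). For \<open>\<tau> = d / 2\<close> the norm is at most \<open>a - d / 2\<close>,
  which is incompatible with a norm between \<open>\<alpha> n\<close> and \<open>\<alpha> (Suc n)\<close> once both are close to \<open>a\<close>.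

  The comparison principle (\<open>comparison_principle\<close>) works with test functions throughout.
  If test functions \<open>\<phi>\<^sub>j\<close> approximate \<open>u\<close>, then \<open>G (\<phi>\<^sub>j - v)\<close> is itself a test function
  when \<open>G\<close> is a smooth function that vanishes exactly on \<open>s \<le> 0\<close>; here \<open>G\<close> is \<open>flat\<close>,
  with \<open>flat s = exp (- 1 / s)\<close> for \<open>s > 0\<close>. The weak equation tested with it passes to the limit because \<open>G\<close> is nondecreasing and
  Lipschitz. The remaining groundwork is integration by parts against test functions
  (\<open>integral_derivative_eq_0\<close>) and the fundamental lemma of the calculus of variations
  (\<open>fundamental_lemma\<close>), which makes the weak gradient unique and thus identifies it with the
  classical one on test functions.
\<close>

section \<open>Calculus of smooth functions\<close>

lemma Ck_on_Suc_imp: "Ck_on (Suc k) f UNIV \<Longrightarrow> Ck_on k f UNIV"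
proof (induction k arbitrary: f)
  case 0
  then show ?case
    by (auto intro!: differentiable_imp_continuous_on simp: differentiable_on_def)
next
  case (Suc k)
  then show ?case
    by (metis Ck_on.simps(2))
qed

lemma Ck_on_zero: "Ck_on k (\<lambda>x::'a::euclidean_space. 0::real) UNIV"
  by (induction k) auto

lemma Ck_on_const: "Ck_on k (\<lambda>x::'a::euclidean_space. c::real) UNIV"
  by (cases k) (auto simp: Ck_on_zero)

lemma frechet_derivative_eqI:
  "(f has_derivative D) (at x) \<Longrightarrow> frechet_derivative f (at x) = D"
  by (metis frechet_derivative_at)

lemma Ck_on_add: "Ck_on k f UNIV \<Longrightarrow> Ck_on k g UNIV \<Longrightarrow> Ck_on k (\<lambda>x. f x + g x) UNIV"
proof (induction k arbitrary: f g)
  case 0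
  then show ?case by (auto intro: continuous_intros)
next
  case (Suc k)
  have "frechet_derivative (\<lambda>x. f x + g x) (at x) v
      = frechet_derivative f (at x) v + frechet_derivative g (at x) v" for x v
    using Suc.prems
    by (subst frechet_derivative_eqI[OF has_derivative_add[OF frechet_derivative_works[THEN iffD1] frechet_derivative_works[THEN iffD1]]]) auto
  with Suc show ?case by (auto intro!: derivative_intros)
qed

lemma frechet_derivative_mult_real:
  fixes f g :: "'a::euclidean_space \<Rightarrow> real"
  assumes "f differentiable (at x)" "g differentiable (at x)"
  shows "frechet_derivative (\<lambda>x. f x * g x) (at x) v
      = f x * frechet_derivative g (at x) v + frechet_derivative f (at x) v * g x"
  by (subst frechet_derivative_eqI[OF has_derivative_mult[OF frechet_derivative_works[THEN iffD1] frechet_derivative_works[THEN iffD1]]])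
     (use assms in auto)

lemma Ck_on_mult: "Ck_on k f UNIV \<Longrightarrow> Ck_on k g UNIV \<Longrightarrow> Ck_on k (\<lambda>x. f x * g x) UNIV"
proof (induction k arbitrary: f g)
  case 0
  then show ?case by (auto intro: continuous_intros)
next
  case (Suc k)
  have diff: "f differentiable (at x)" "g differentiable (at x)" for x
    using Suc.prems by auto
  have "Ck_on k (\<lambda>x. f x * frechet_derivative g (at x) v + frechet_derivative f (at x) v * g x) UNIV" for v
    using Suc.prems Ck_on_Suc_imp by (intro Ck_on_add Suc.IH) auto
  moreover have "(\<lambda>x. f x * g x) differentiable (at x)" for x
    using diff by (auto intro: derivative_intros)
  ultimately show ?case
    by (auto simp: frechet_derivative_mult_real[OF diff])
qed

lemma has_derivative_compose_real:
  fixes w :: "'a::euclidean_space \<Rightarrow> real"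
  assumes "w differentiable (at x)" "(h has_real_derivative d) (at (w x))"
  shows "((\<lambda>x. h (w x)) has_derivative (\<lambda>v. d * frechet_derivative w (at x) v)) (at x)"
  using has_derivative_compose[OF frechet_derivative_works[THEN iffD1, OF assms(1)],
      of h "\<lambda>y. d * y"] assms(2)
  by (simp add: has_field_derivative_def)

text \<open>The hypothesis says that \<open>H 0\<close> is infinitely differentiable, with \<open>j\<close>-th derivative
  \<open>H j\<close>; carrying the whole family makes the chain rule an induction.\<close>

lemma Ck_on_compose_real:
  fixes H :: "nat \<Rightarrow> real \<Rightarrow> real"
  assumes H: "\<And>j s. (H j has_real_derivative H (Suc j) s) (at s)"
  shows "Ck_on k w UNIV \<Longrightarrow> Ck_on k (\<lambda>x. H j (w x)) UNIV"
proof (induction k arbitrary: j)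
  case 0
  have "continuous_on UNIV (H j)"
    by (meson DERIV_isCont H continuous_at_imp_continuous_on)
  then show ?case using 0
    by (auto intro: continuous_on_compose2)
next
  case (Suc k)
  have d: "((\<lambda>x. H j (w x)) has_derivative (\<lambda>v. H (Suc j) (w x) * frechet_derivative w (at x) v)) (at x)" for x
    using Suc.prems H by (intro has_derivative_compose_real) auto
  have "Ck_on k (\<lambda>x. H (Suc j) (w x) * frechet_derivative w (at x) v) UNIV" for v
    using Suc.prems Ck_on_Suc_imp by (intro Ck_on_mult Suc.IH) auto
  moreover have "(\<lambda>x. H j (w x)) differentiable (at x)" for x
    using d by (auto simp: differentiable_def)
  ultimately show ?case
    by (auto simp: frechet_derivative_eqI[OF d])
qed

lemma smooth_on_const: "smooth_on (\<lambda>x::'a::euclidean_space. c::real) UNIV"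
  by (simp add: smooth_on_def Ck_on_const)

lemma smooth_on_add: "smooth_on f UNIV \<Longrightarrow> smooth_on g UNIV \<Longrightarrow> smooth_on (\<lambda>x. f x + g x) UNIV"
  by (simp add: smooth_on_def Ck_on_add)

lemma smooth_on_mult: "smooth_on f UNIV \<Longrightarrow> smooth_on g UNIV \<Longrightarrow> smooth_on (\<lambda>x. f x * g x) UNIV"
  by (simp add: smooth_on_def Ck_on_mult)

lemma smooth_on_cmult: "smooth_on f UNIV \<Longrightarrow> smooth_on (\<lambda>x. c * f x) UNIV"
  by (simp add: smooth_on_mult smooth_on_const)

lemma smooth_on_uminus: "smooth_on f UNIV \<Longrightarrow> smooth_on (\<lambda>x. - f x) UNIV"
  using smooth_on_cmult[of f "-1"] by simp

lemma smooth_on_diff: "smooth_on f UNIV \<Longrightarrow> smooth_on g UNIV \<Longrightarrow> smooth_on (\<lambda>x. f x - g x) UNIV"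
  using smooth_on_add[of f "\<lambda>x. - g x"] smooth_on_uminus[of g] by simp

lemma smooth_on_sum:
  "(\<And>i. i \<in> I \<Longrightarrow> smooth_on (f i) UNIV) \<Longrightarrow> smooth_on (\<lambda>x. \<Sum>i\<in>I. f i x) UNIV"
  by (induction I rule: infinite_finite_induct) (auto simp: smooth_on_const smooth_on_add)

lemma smooth_on_compose_real:
  assumes "\<And>j s. (H j has_real_derivative H (Suc j) s) (at s)" "smooth_on w UNIV"
  shows "smooth_on (\<lambda>x. H j (w x)) UNIV"
  using assms by (simp add: smooth_on_def Ck_on_compose_real)

lemma smooth_on_inner: "smooth_on (\<lambda>x::'a::euclidean_space. x \<bullet> e) UNIV"
  unfolding smooth_on_def
proof
  fix k
  have d: "((\<lambda>x. x \<bullet> e) has_derivative (\<lambda>v. v \<bullet> e)) (at x)" for x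
    by (auto intro!: derivative_eq_intros)
  show "Ck_on k (\<lambda>x. x \<bullet> e) UNIV"
    by (cases k) (auto intro!: continuous_intros Ck_on_const simp: frechet_derivative_eqI[OF d] differentiable_def intro: d)
qed

lemma smooth_on_norm_square: "smooth_on (\<lambda>x::'a::euclidean_space. (norm (x - c))\<^sup>2) UNIV"
proof -
  have "(norm (x - c))\<^sup>2 = (\<Sum>i\<in>Basis. (x \<bullet> i - c \<bullet> i) * (x \<bullet> i - c \<bullet> i))" for x
    unfolding power2_norm_eq_inner
    by (subst euclidean_inner) (simp add: inner_diff_left)
  then show ?thesis
    by (auto intro!: smooth_on_sum smooth_on_mult smooth_on_diff smooth_on_inner smooth_on_const)
qed

lemma smooth_on_exp: "smooth_on w UNIV \<Longrightarrow> smooth_on (\<lambda>x. exp (w x :: real)) UNIV"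
  using smooth_on_compose_real[of "\<lambda>j. exp" w 0] by (auto intro: DERIV_exp)

lemma smooth_on_differentiable: "smooth_on f UNIV \<Longrightarrow> f differentiable (at x)"
  unfolding smooth_on_def by (metis Ck_on.simps(2) UNIV_I)

lemma smooth_on_has_derivative:
  "smooth_on f UNIV \<Longrightarrow> (f has_derivative (\<lambda>v. frechet_derivative f (at x) v)) (at x)"
  by (simp add: frechet_derivative_works[symmetric] smooth_on_differentiable)

lemma smooth_on_derivative: "smooth_on f UNIV \<Longrightarrow> smooth_on (\<lambda>x. frechet_derivative f (at x) v) UNIV"
  unfolding smooth_on_def by (metis Ck_on.simps(2))

lemma smooth_on_continuous: "smooth_on f UNIV \<Longrightarrow> continuous_on S f"
  unfolding smooth_on_def using Ck_on.simps(1) continuous_on_subset by blast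

definition grad :: "('a::euclidean_space \<Rightarrow> real) \<Rightarrow> 'a \<Rightarrow> 'a" where
  "grad f x = (\<Sum>i\<in>Basis. frechet_derivative f (at x) i *\<^sub>R i)"

definition laplacian :: "('a::euclidean_space \<Rightarrow> real) \<Rightarrow> 'a \<Rightarrow> real" where
  "laplacian f x = (\<Sum>i\<in>Basis. frechet_derivative (\<lambda>y. frechet_derivative f (at y) i) (at x) i)"

lemma grad_inner_Basis: "i \<in> Basis \<Longrightarrow> grad f x \<bullet> i = frechet_derivative f (at x) i"
  by (simp add: grad_def inner_sum_left_Basis)

lemma grad_eqI:
  assumes "(f has_derivative (\<lambda>v. g \<bullet> v)) (at x)" shows "grad f x = g"
  by (simp add: grad_def frechet_derivative_eqI[OF assms] euclidean_representation)

lemma has_derivative_grad: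
  assumes "smooth_on f UNIV"
  shows "(f has_derivative (\<lambda>v. grad f x \<bullet> v)) (at x)"
proof -
  have lin: "linear (frechet_derivative f (at x))"
    by (rule linear_frechet_derivative[OF smooth_on_differentiable[OF assms]])
  have "frechet_derivative f (at x) v = grad f x \<bullet> v" for v
  proof -
    have "frechet_derivative f (at x) v = frechet_derivative f (at x) (\<Sum>i\<in>Basis. (v \<bullet> i) *\<^sub>R i)"
      by (simp add: euclidean_representation)
    also have "\<dots> = (\<Sum>i\<in>Basis. (v \<bullet> i) * frechet_derivative f (at x) i)"
      by (simp add: linear_sum[OF lin] linear_scale[OF lin])
    also have "\<dots> = grad f x \<bullet> v"
      by (simp add: grad_def inner_sum_left inner_sum_right inner_commute mult.commute)
    finally show ?thesis .
  qed
  then show ?thesis using smooth_on_has_derivative[OF assms, of x] by simp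
qed

lemma continuous_on_grad: "smooth_on f UNIV \<Longrightarrow> continuous_on S (grad f)"
  unfolding grad_def
  by (intro continuous_intros smooth_on_continuous smooth_on_derivative)

lemma smooth_on_laplacian: "smooth_on f UNIV \<Longrightarrow> smooth_on (laplacian f) UNIV"
  unfolding laplacian_def by (intro smooth_on_sum smooth_on_derivative)

lemma grad_diff:
  "smooth_on f UNIV \<Longrightarrow> smooth_on g UNIV \<Longrightarrow> grad (\<lambda>x. f x - g x) x = grad f x - grad g x"
  by (rule grad_eqI) (auto simp: inner_diff_left intro!: derivative_intros has_derivative_grad)

lemma grad_uminus: "smooth_on f UNIV \<Longrightarrow> grad (\<lambda>x. - f x) x = - grad f x"
  by (rule grad_eqI) (auto intro!: derivative_intros has_derivative_grad)

lemma grad_compose_real: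
  assumes "smooth_on w UNIV" "(h has_real_derivative d) (at (w x))"
  shows "grad (\<lambda>x. h (w x)) x = d *\<^sub>R grad w x"
  using has_derivative_compose_real[OF smooth_on_differentiable[OF assms(1)] assms(2)]
  by (simp add: grad_def frechet_derivative_eqI scaleR_sum_right)

section \<open>A smooth function that vanishes exactly on the nonpositive half-line\<close>

text \<open>The derivatives of \<open>exp (- 1 / s)\<close> are polynomials in \<open>1 / s\<close> times \<open>exp (- 1 / s)\<close>; this
  recursion is the derivative rule written for \<open>t = 1 / s\<close>.\<close>

primrec flat_poly :: "nat \<Rightarrow> real poly" where
  "flat_poly 0 = 1"
| "flat_poly (Suc j) = [:0, 0, 1:] * (flat_poly j - pderiv (flat_poly j))"

definition flat_deriv :: "nat \<Rightarrow> real \<Rightarrow> real" where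
  "flat_deriv j s = (if s \<le> 0 then 0 else poly (flat_poly j) (1 / s) * exp (- 1 / s))"

abbreviation flat :: "real \<Rightarrow> real" where "flat \<equiv> flat_deriv 0"

lemma poly_exp_tendsto_0: "((\<lambda>t. poly p t * exp (- t)) \<longlongrightarrow> (0::real)) at_top"
proof -
  have "((\<lambda>t. \<Sum>i\<le>degree p. coeff p i * (t ^ i / exp t)) \<longlongrightarrow> (\<Sum>i\<le>degree p. coeff p i * 0)) at_top"
    by (intro tendsto_intros tendsto_power_div_exp_0)
  then show ?thesis
    by (simp add: poly_altdef sum_distrib_right exp_minus divide_inverse mult.assoc)
qed

lemma flat_deriv_has_derivative: "(flat_deriv j has_real_derivative flat_deriv (Suc j) s) (at s)"
proof -
  consider "s < 0" | "s > 0" | "s = 0" by linarith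
  then show ?thesis
  proof cases
    case 1
    have "((\<lambda>s. 0) has_real_derivative 0) (at s)" by simp
    then have "(flat_deriv j has_real_derivative 0) (at s)"
      by (rule has_field_derivative_transform_within_open[where S="{..<0}"])
         (use 1 in \<open>auto simp: flat_deriv_def\<close>)
    then show ?thesis using 1 by (simp add: flat_deriv_def)
  next
    case 2
    have "((\<lambda>s. poly (flat_poly j) (1 / s) * exp (- 1 / s)) has_real_derivative
        poly (flat_poly (Suc j)) (1 / s) * exp (- 1 / s)) (at s)"
      using 2 by (auto intro!: derivative_eq_intros DERIV_chain2[where f="poly (flat_poly j)", OF poly_DERIV]
          simp: field_simps power2_eq_square)
    then have "(flat_deriv j has_real_derivative poly (flat_poly (Suc j)) (1 / s) * exp (- 1 / s)) (at s)"
      by (rule has_field_derivative_transform_within_open[where S="{0<..}"])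
         (use 2 in \<open>auto simp: flat_deriv_def\<close>)
    then show ?thesis using 2 by (simp add: flat_deriv_def)
  next
    case 3
    \<comment> \<open>The quotient \<open>flat_deriv j h / h\<close> is again a polynomial in \<open>1 / h\<close> times \<open>exp (- 1 / h)\<close>.\<close>
    have "((\<lambda>t. poly (pCons 0 (flat_poly j)) t * exp (- t)) \<longlongrightarrow> 0) at_top"
      by (rule poly_exp_tendsto_0)
    then have "((\<lambda>h. poly (pCons 0 (flat_poly j)) (inverse h) * exp (- inverse h)) \<longlongrightarrow> 0) (at_right 0)"
      by (rule filterlim_compose[OF _ filterlim_inverse_at_top_right])
    then have right: "((\<lambda>h. flat_deriv j h / h) \<longlongrightarrow> 0) (at_right 0)"
      by (rule Lim_transform_eventually)
         (auto simp: eventually_at_filter flat_deriv_def field_simps)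
    have left: "((\<lambda>h. flat_deriv j h / h) \<longlongrightarrow> 0) (at_left 0)"
      by (rule Lim_transform_eventually[OF tendsto_const])
         (auto simp: eventually_at_filter flat_deriv_def)
    have "((\<lambda>h. flat_deriv j h / h) \<longlongrightarrow> 0) (at 0)"
      using left right by (rule filterlim_split_at)
    then show ?thesis
      using 3 by (simp add: DERIV_def flat_deriv_def)
  qed
qed

lemma flat_pos: "s > 0 \<Longrightarrow> flat s > 0" and flat_nonpos: "s \<le> 0 \<Longrightarrow> flat s = 0"
  by (auto simp: flat_deriv_def)

lemma flat_nonneg: "0 \<le> flat s"
  using flat_pos[of s] flat_nonpos[of s] by linarith

lemma flat_slope_bounds: "0 \<le> flat_deriv (Suc 0) s" "flat_deriv (Suc 0) s \<le> 2"
proof -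
  have *: "t * t * exp (- t) \<le> 2" if "t > 0" for t :: real
  proof -
    have "t * t / 2 \<le> exp t"
      using exp_lower_Taylor_quadratic[of t] that by (simp add: power2_eq_square)
    then show ?thesis by (simp add: exp_minus field_simps)
  qed
  show "0 \<le> flat_deriv (Suc 0) s" "flat_deriv (Suc 0) s \<le> 2"
    using *[of "1 / s"] by (auto simp: flat_deriv_def)
qed

lemma flat_lipschitz: "\<bar>flat s - flat t\<bar> \<le> 2 * \<bar>s - t\<bar>"
proof -
  have "norm (flat s - flat t) \<le> 2 * norm (s - t)"
    by (rule field_differentiable_bound[of UNIV flat "flat_deriv (Suc 0)"])
       (auto intro: flat_deriv_has_derivative simp: flat_slope_bounds)
  then show ?thesis by simp
qed

lemma smooth_on_flat: "smooth_on w UNIV \<Longrightarrow> smooth_on (\<lambda>x. flat (w x)) UNIV"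
  by (rule smooth_on_compose_real[where H = flat_deriv and j = 0, OF flat_deriv_has_derivative])

section \<open>Test functions\<close>

lemma test_functions_smooth: "\<phi> \<in> test_functions \<Omega> \<Longrightarrow> smooth_on \<phi> UNIV"
  by (simp add: test_functions_def)

lemma test_functions_support:
  assumes "smooth_on h UNIV" "\<phi> \<in> test_functions \<Omega>" "\<And>x. \<phi> x = 0 \<Longrightarrow> h x = 0"
  shows "h \<in> test_functions \<Omega>"
proof -
  have sub: "closure {x. h x \<noteq> 0} \<subseteq> closure {x. \<phi> x \<noteq> 0}"
    using assms(3) by (intro closure_mono) auto
  moreover have "compact (closure {x. h x \<noteq> 0})"
    using compact_Int_closed[of "closure {x. \<phi> x \<noteq> 0}" "closure {x. h x \<noteq> 0}"] sub assms(2)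
    by (simp add: test_functions_def inf.absorb2)
  ultimately show ?thesis
    using assms by (auto simp: test_functions_def)
qed

lemma test_functions_mult:
  "smooth_on w UNIV \<Longrightarrow> \<phi> \<in> test_functions \<Omega> \<Longrightarrow> (\<lambda>x. w x * \<phi> x) \<in> test_functions \<Omega>"
  by (rule test_functions_support) (auto intro: smooth_on_mult test_functions_smooth)

lemma test_functions_zero: "(\<lambda>x. 0) \<in> test_functions \<Omega>"
  by (simp add: test_functions_def smooth_on_const)

lemma test_functions_uminus: "\<phi> \<in> test_functions \<Omega> \<Longrightarrow> (\<lambda>x. - \<phi> x) \<in> test_functions \<Omega>"
  by (rule test_functions_support) (auto intro: smooth_on_uminus test_functions_smooth)

lemma test_function_bounded_support:
  assumes "\<phi> \<in> test_functions \<Omega>"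
  obtains R where "R > 0" "\<And>x. norm x \<ge> R \<Longrightarrow> \<phi> x = 0"
proof -
  have "bounded (closure {x. \<phi> x \<noteq> 0})"
    using assms by (simp add: test_functions_def compact_imp_bounded)
  then obtain R where R: "\<forall>x\<in>closure {x. \<phi> x \<noteq> 0}. norm x < R" "R > 0"
    using bounded_pos_less by blast
  then have "norm x \<ge> R \<Longrightarrow> \<phi> x = 0" for x
    using closure_subset[of "{x. \<phi> x \<noteq> 0}"] by force
  with R that show ?thesis by blast
qed

lemma derivative_outside_support:
  assumes "x \<notin> closure {x. \<phi> x \<noteq> (0::real)}"
  shows "frechet_derivative \<phi> (at x) i = 0"
proof -
  define S where "S = - closure {x. \<phi> x \<noteq> 0}"
  have S: "open S" "x \<in> S" using assms by (auto simp: S_def open_closed)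
  have zero: "0 = \<phi> y" if "y \<in> S" for y
    using that closure_subset[of "{x. \<phi> x \<noteq> 0}"] unfolding S_def by auto
  have "(\<phi> has_derivative (\<lambda>v. 0)) (at x)"
    by (rule has_derivative_transform_within_open[OF has_derivative_const S zero])
  then show ?thesis by (simp add: frechet_derivative_eqI)
qed

lemma test_functions_derivative:
  assumes "\<phi> \<in> test_functions \<Omega>"
  shows "(\<lambda>x. frechet_derivative \<phi> (at x) i) \<in> test_functions \<Omega>"
proof -
  have sub: "closure {x. frechet_derivative \<phi> (at x) i \<noteq> 0} \<subseteq> closure {x. \<phi> x \<noteq> 0}"
  proof (rule closure_minimal)
    show "{x. frechet_derivative \<phi> (at x) i \<noteq> 0} \<subseteq> closure {x. \<phi> x \<noteq> 0}"
    proof (rule subsetI, rule ccontr)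
      fix x assume "x \<in> {x. frechet_derivative \<phi> (at x) i \<noteq> 0}" "x \<notin> closure {x. \<phi> x \<noteq> 0}"
      then show False using derivative_outside_support[of x \<phi> i] by simp
    qed
  qed simp
  moreover have "compact (closure {x. frechet_derivative \<phi> (at x) i \<noteq> 0})"
    using compact_Int_closed[of "closure {x. \<phi> x \<noteq> 0}" "closure {x. frechet_derivative \<phi> (at x) i \<noteq> 0}"] sub assms
    by (simp add: test_functions_def inf.absorb2)
  ultimately show ?thesis
    using assms by (auto simp: test_functions_def intro: smooth_on_derivative)
qed

lemma test_function_bounded:
  assumes "\<phi> \<in> test_functions \<Omega>"
  obtains B where "B > 0" "\<And>x. \<bar>\<phi> x\<bar> \<le> B"
proof -
  have "bounded (\<phi> ` closure {x. \<phi> x \<noteq> 0})"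
    using assms by (auto simp: test_functions_def intro!: compact_imp_bounded compact_continuous_image smooth_on_continuous)
  then obtain B where B: "B > 0" "\<And>x. x \<in> closure {x. \<phi> x \<noteq> 0} \<Longrightarrow> \<bar>\<phi> x\<bar> \<le> B"
    unfolding bounded_pos by auto
  have "\<bar>\<phi> x\<bar> \<le> B" for x
    using B closure_subset[of "{x. \<phi> x \<noteq> 0}"] by (cases "\<phi> x = 0") auto
  with B(1) that show ?thesis by blast
qed

lemma smooth_on_measurable [measurable]: "smooth_on w UNIV \<Longrightarrow> w \<in> borel_measurable borel"
  by (intro borel_measurable_continuous_onI smooth_on_continuous)

lemma borel_imp_lebesgue_on:
  "f \<in> borel_measurable borel \<Longrightarrow> f \<in> borel_measurable (lebesgue_on S)"
  by (metis measurable_completion measurable_lborel2 measurable_restrict_space1)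

lemma smooth_on_measurable_lebesgue_on:
  "smooth_on w UNIV \<Longrightarrow> w \<in> borel_measurable (lebesgue_on S)"
  by (simp add: borel_imp_lebesgue_on smooth_on_measurable)

text \<open>Translation invariance makes the integrals of all difference quotients vanish, and the
  derivative is their dominated limit.\<close>

lemma integral_derivative_eq_0:
  fixes h :: "'a::euclidean_space \<Rightarrow> real"
  assumes h: "h \<in> test_functions \<Omega>"
  shows "(LINT x|lborel. frechet_derivative h (at x) e) = 0"
proof -
  note sm = test_functions_smooth[OF h]
  obtain R where R: "R > 0" "\<And>x. norm x \<ge> R \<Longrightarrow> h x = 0"
    using test_function_bounded_support[OF h] by blast
  obtain B where B: "B > 0" "\<And>x. \<bar>frechet_derivative h (at x) e\<bar> \<le> B"
    using test_function_bounded[OF test_functions_derivative[OF h]] by blast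
  define t where "t n = 1 / real (Suc n)" for n
  have t: "0 < t n" "t n \<le> 1" for n by (auto simp: t_def)
  have t0: "t \<longlonglongrightarrow> 0" unfolding t_def by (rule LIMSEQ_Suc[OF lim_1_over_n])
  have D: "((\<lambda>s. h (x + s *\<^sub>R e)) has_real_derivative frechet_derivative h (at (x + s *\<^sub>R e)) e) (at s)" for x s
  proof -
    have "((\<lambda>s. h (x + s *\<^sub>R e)) has_derivative (\<lambda>r. frechet_derivative h (at (x + s *\<^sub>R e)) (r *\<^sub>R e))) (at s)"
      by (rule has_derivative_compose[OF _ smooth_on_has_derivative[OF sm]])
         (auto intro!: derivative_eq_intros)
    moreover have "frechet_derivative h (at y) (r *\<^sub>R e) = frechet_derivative h (at y) e * r" for y r
      using linear_scale[OF linear_frechet_derivative[OF smooth_on_differentiable[OF sm]]] by simp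
    ultimately show ?thesis by (simp add: has_field_derivative_def)
  qed
  define q where "q n x = (h (x + t n *\<^sub>R e) - h x) / t n" for n x
  have int_h: "integrable lborel h"
  proof -
    have "integrable lborel (\<lambda>x. indicator (cball 0 R) x *\<^sub>R h x)"
      by (rule borel_integrable_compact) (auto intro: smooth_on_continuous[OF sm])
    moreover have "(\<lambda>x. indicator (cball 0 R) x *\<^sub>R h x) = h"
      using R(2) by (fastforce simp: indicator_def)
    ultimately show ?thesis by metis
  qed
  have int_t: "integrable lborel (\<lambda>x. h (x + c))" "(LINT x|lborel. h (x + c)) = (LINT x|lborel. h x)" for c
  proof -
    have d: "distr lborel borel ((+) c) = lborel" by (rule lborel_distr_plus)
    have "integrable (distr lborel borel ((+) c)) h" using int_h d by simp
    then show "integrable lborel (\<lambda>x. h (x + c))"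
      by (subst (asm) integrable_distr_eq) (auto simp: add.commute sm smooth_on_measurable)
    have "(LINT x|distr lborel borel ((+) c). h x) = (LINT x|lborel. h (c + x))"
      by (subst integral_distr) (auto simp: sm smooth_on_measurable)
    then show "(LINT x|lborel. h (x + c)) = (LINT x|lborel. h x)"
      using d by (simp add: add.commute)
  qed
  have q0: "(LINT x|lborel. q n x) = 0" for n
    unfolding q_def using int_h int_t by simp
  have "(\<lambda>n. LINT x|lborel. q n x) \<longlonglongrightarrow> (LINT x|lborel. frechet_derivative h (at x) e)"
  proof (rule integral_dominated_convergence[where w = "\<lambda>x. B * indicator (cball 0 (R + norm e)) x"])
    show "(\<lambda>x. frechet_derivative h (at x) e) \<in> borel_measurable lborel"
      by (simp add: smooth_on_derivative[OF sm] smooth_on_measurable)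
    show "q n \<in> borel_measurable lborel" for n
      using int_t int_h unfolding q_def by (auto intro: borel_measurable_integrable)
    show "integrable lborel (\<lambda>x. B * indicator (cball 0 (R + norm e)) x :: real)"
      by (intro integrable_mult_right integrable_real_indicator) (use emeasure_bounded_finite[OF bounded_cball] in \<open>auto simp: top.not_eq_extremum\<close>)
    show "AE x in lborel. (\<lambda>n. q n x) \<longlonglongrightarrow> frechet_derivative h (at x) e"
    proof (rule AE_I2)
      fix x
      have "((\<lambda>s. (h (x + s *\<^sub>R e) - h x) / s) \<longlongrightarrow> frechet_derivative h (at x) e) (at 0)"
        using D[of x 0] by (simp add: DERIV_def)
      moreover have "filterlim t (at 0) sequentially"
        using t0 t(1) by (auto simp: filterlim_at intro!: always_eventually less_imp_neq[symmetric])
      ultimately show "(\<lambda>n. q n x) \<longlonglongrightarrow> frechet_derivative h (at x) e"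
        unfolding q_def by (rule filterlim_compose)
    qed
    show "AE x in lborel. norm (q n x) \<le> B * indicator (cball 0 (R + norm e)) x" for n
    proof (rule AE_I2)
      fix x
      show "norm (q n x) \<le> B * indicator (cball 0 (R + norm e)) x"
      proof (cases "x \<in> cball 0 (R + norm e)")
        case True
        have "norm (h (x + t n *\<^sub>R e) - h (x + 0 *\<^sub>R e)) \<le> B * norm (t n - 0)"
          by (rule field_differentiable_bound[of UNIV "\<lambda>s. h (x + s *\<^sub>R e)" "\<lambda>s. frechet_derivative h (at (x + s *\<^sub>R e)) e"])
             (auto intro: D simp: B)
        then show ?thesis using True t[of n] by (simp add: q_def field_simps)
      next
        case False
        then have x: "norm x > R + norm e" by simp
        have "norm (t n *\<^sub>R e) \<le> norm e" using t[of n] by (simp add: mult_left_le_one_le)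
        then have "norm (x + t n *\<^sub>R e) \<ge> R"
          using x norm_diff_ineq[of x "t n *\<^sub>R e"] by linarith
        moreover have "norm x \<ge> R" using x norm_ge_zero[of e] by linarith
        ultimately show ?thesis using False R(2) by (simp add: q_def)
      qed
    qed
  qed
  then show ?thesis unfolding q0 by (simp add: LIMSEQ_const_iff)
qed

lemma integral_lebesgue_on_test_function:
  assumes "open \<Omega>" "h \<in> test_functions \<Omega>"
  shows "(LINT x|lebesgue_on \<Omega>. h x) = (LINT x|lborel. h x)"
proof -
  have "\<Omega> \<in> sets lebesgue" using assms(1) by auto
  moreover have "(\<lambda>x. indicator \<Omega> x *\<^sub>R h x) = h"
    using assms(2) closure_subset[of "{x. h x \<noteq> 0}"] by (fastforce simp: test_functions_def indicator_def)
  ultimately have "(LINT x|lebesgue_on \<Omega>. h x) = (LINT x|lebesgue. h x)"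
    using integral_restrict_space[of \<Omega> lebesgue h] by auto
  also have "\<dots> = (LINT x|lborel. h x)"
    using smooth_on_measurable[OF test_functions_smooth[OF assms(2)]] by (simp add: integral_completion)
  finally show ?thesis .
qed

lemma integrable_bounded_lebesgue_on:
  fixes f :: "'a::euclidean_space \<Rightarrow> 'b::{banach, second_countable_topology}"
  assumes "open \<Omega>" "bounded \<Omega>" "f \<in> borel_measurable (lebesgue_on \<Omega>)" "AE x in lebesgue_on \<Omega>. norm (f x) \<le> B"
  shows "integrable (lebesgue_on \<Omega>) f"
proof -
  interpret finite_measure "lebesgue_on \<Omega>"
    by (rule finite_measure_lebesgue_on) (simp add: assms lmeasurable_open)
  show ?thesis using integrable_const_bound assms by blast
qed

lemma integrable_test_function:
  assumes "open \<Omega>" "bounded \<Omega>" "h \<in> test_functions \<Omega>"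
  shows "integrable (lebesgue_on \<Omega>) h"
proof -
  obtain B where "\<And>x. \<bar>h x\<bar> \<le> B"
    using test_function_bounded[OF assms(3)] by blast
  then show ?thesis
    using assms by (intro integrable_bounded_lebesgue_on[where B=B])
       (auto intro: smooth_on_measurable_lebesgue_on test_functions_smooth)
qed

lemma integration_by_parts:
  assumes "open \<Omega>" "bounded \<Omega>" and w: "smooth_on w UNIV" and h: "\<phi> \<in> test_functions \<Omega>"
  shows "(LINT x|lebesgue_on \<Omega>. w x * frechet_derivative \<phi> (at x) i) =
       - (LINT x|lebesgue_on \<Omega>. frechet_derivative w (at x) i * \<phi> x)"
proof -
  note sm = test_functions_smooth[OF h]
  have eq: "frechet_derivative (\<lambda>x. w x * \<phi> x) (at x) i =
      w x * frechet_derivative \<phi> (at x) i + frechet_derivative w (at x) i * \<phi> x" for x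
    by (simp add: frechet_derivative_mult_real smooth_on_differentiable w sm)
  have "integrable (lebesgue_on \<Omega>) (\<lambda>x. w x * frechet_derivative \<phi> (at x) i)"
       "integrable (lebesgue_on \<Omega>) (\<lambda>x. frechet_derivative w (at x) i * \<phi> x)"
    using assms by (auto intro!: integrable_test_function test_functions_mult test_functions_derivative smooth_on_derivative)
  moreover have "(LINT x|lebesgue_on \<Omega>. frechet_derivative (\<lambda>x. w x * \<phi> x) (at x) i) = 0"
    using assms by (subst integral_lebesgue_on_test_function)
      (auto intro!: test_functions_mult test_functions_derivative integral_derivative_eq_0)
  ultimately show ?thesis
    unfolding eq by simp
qed

section \<open>Square-integrable functions\<close>

lemma L2_measurable: "u \<in> L2 \<Omega> \<Longrightarrow> u \<in> borel_measurable (lebesgue_on \<Omega>)"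
  by (simp add: L2_def)

lemma L2_square_integrable: "u \<in> L2 \<Omega> \<Longrightarrow> integrable (lebesgue_on \<Omega>) (\<lambda>x. (norm (u x))\<^sup>2)"
  by (simp add: L2_def)

lemma L2_bounded:
  assumes "open \<Omega>" "bounded \<Omega>" "u \<in> borel_measurable (lebesgue_on \<Omega>)"
    "AE x in lebesgue_on \<Omega>. norm (u x) \<le> B"
  shows "u \<in> L2 \<Omega>"
proof -
  have "AE x in lebesgue_on \<Omega>. norm ((norm (u x))\<^sup>2) \<le> B\<^sup>2"
    using assms(4) by eventually_elim (simp add: power_mono)
  then have "integrable (lebesgue_on \<Omega>) (\<lambda>x. (norm (u x))\<^sup>2)"
    using assms by (intro integrable_bounded_lebesgue_on) auto
  then show ?thesis using assms by (simp add: L2_def)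
qed

lemma L2_continuous:
  assumes "open \<Omega>" "bounded \<Omega>" "continuous_on UNIV u"
  shows "u \<in> L2 \<Omega>"
proof -
  have "compact (closure \<Omega>)" using assms(2) by simp
  then have "bounded (u ` closure \<Omega>)"
    using assms(3) by (intro compact_imp_bounded compact_continuous_image) (auto intro: continuous_on_subset)
  then obtain B where B: "\<And>x. x \<in> closure \<Omega> \<Longrightarrow> norm (u x) \<le> B"
    unfolding bounded_iff by auto
  have "AE x in lebesgue_on \<Omega>. norm (u x) \<le> B"
    using B closure_subset by (intro AE_I2) auto
  then show ?thesis
    using assms by (intro L2_bounded) (auto intro: borel_imp_lebesgue_on borel_measurable_continuous_onI)
qed

lemma L2_smooth: "open \<Omega> \<Longrightarrow> bounded \<Omega> \<Longrightarrow> smooth_on u UNIV \<Longrightarrow> u \<in> L2 \<Omega>"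
  by (simp add: L2_continuous smooth_on_continuous)

lemma L2_grad: "open \<Omega> \<Longrightarrow> bounded \<Omega> \<Longrightarrow> smooth_on u UNIV \<Longrightarrow> grad u \<in> L2 \<Omega>"
  by (simp add: L2_continuous continuous_on_grad)

lemma integrable_norm_mult_L2:
  assumes "u \<in> L2 \<Omega>" "v \<in> L2 \<Omega>"
  shows "integrable (lebesgue_on \<Omega>) (\<lambda>x. norm (u x) * norm (v x))"
proof (rule Bochner_Integration.integrable_bound[where f = "\<lambda>x. (norm (u x))\<^sup>2 + (norm (v x))\<^sup>2"])
  show "integrable (lebesgue_on \<Omega>) (\<lambda>x. (norm (u x))\<^sup>2 + (norm (v x))\<^sup>2)"
    using assms by (simp add: L2_def)
  show "(\<lambda>x. norm (u x) * norm (v x)) \<in> borel_measurable (lebesgue_on \<Omega>)"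
    using assms[THEN L2_measurable] by measurable
  have "p * q \<le> p\<^sup>2 + q\<^sup>2" if "0 \<le> p" "0 \<le> q" for p q :: real
    using sum_squares_bound[of p q] mult_nonneg_nonneg[OF that] by simp
  then show "AE x in lebesgue_on \<Omega>. norm (norm (u x) * norm (v x)) \<le> norm ((norm (u x))\<^sup>2 + (norm (v x))\<^sup>2)"
    by (intro AE_I2) auto
qed

lemma integrable_inner_L2:
  assumes "u \<in> L2 \<Omega>" "v \<in> L2 \<Omega>"
  shows "integrable (lebesgue_on \<Omega>) (\<lambda>x. u x \<bullet> v x)"
  using assms Cauchy_Schwarz_ineq2
  by (intro Bochner_Integration.integrable_bound[OF integrable_norm_mult_L2[OF assms]]) (auto simp: L2_def)

lemma integrable_mult_L2:
  fixes u v :: "'a::euclidean_space \<Rightarrow> real"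
  shows "u \<in> L2 \<Omega> \<Longrightarrow> v \<in> L2 \<Omega> \<Longrightarrow> integrable (lebesgue_on \<Omega>) (\<lambda>x. u x * v x)"
  using integrable_inner_L2[of u \<Omega> v] by simp

lemma L2_add:
  assumes "u \<in> L2 \<Omega>" "v \<in> L2 \<Omega>"
  shows "(\<lambda>x. u x + v x) \<in> L2 \<Omega>"
proof -
  have "integrable (lebesgue_on \<Omega>) (\<lambda>x. (norm (u x + v x))\<^sup>2)"
  proof (rule Bochner_Integration.integrable_bound[where f = "\<lambda>x. (norm (u x))\<^sup>2 + (norm (v x))\<^sup>2 + 2 * (norm (u x) * norm (v x))"])
    show "integrable (lebesgue_on \<Omega>) (\<lambda>x. (norm (u x))\<^sup>2 + (norm (v x))\<^sup>2 + 2 * (norm (u x) * norm (v x)))"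
      using assms integrable_norm_mult_L2[OF assms] by (simp add: L2_def)
    show "(\<lambda>x. (norm (u x + v x))\<^sup>2) \<in> borel_measurable (lebesgue_on \<Omega>)"
      using assms[THEN L2_measurable] by measurable
    have "(norm (u x + v x))\<^sup>2 \<le> (norm (u x) + norm (v x))\<^sup>2" for x
      by (intro power_mono norm_triangle_ineq norm_ge_zero)
    then show "AE x in lebesgue_on \<Omega>. norm ((norm (u x + v x))\<^sup>2)
        \<le> norm ((norm (u x))\<^sup>2 + (norm (v x))\<^sup>2 + 2 * (norm (u x) * norm (v x)))"
      by (intro AE_I2) (auto simp: power2_sum mult.assoc intro: order_trans)
  qed
  moreover have "(\<lambda>x. u x + v x) \<in> borel_measurable (lebesgue_on \<Omega>)"
    using assms[THEN L2_measurable] by measurable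
  ultimately show ?thesis by (simp add: L2_def)
qed

lemma L2_uminus: "u \<in> L2 \<Omega> \<Longrightarrow> (\<lambda>x. - u x) \<in> L2 \<Omega>"
  by (simp add: L2_def)

lemma L2_diff: "u \<in> L2 \<Omega> \<Longrightarrow> v \<in> L2 \<Omega> \<Longrightarrow> (\<lambda>x. u x - v x) \<in> L2 \<Omega>"
  using L2_add[OF _ L2_uminus, of u \<Omega> v] by simp

lemma L2_inner_Basis:
  assumes "g \<in> L2 \<Omega>" "i \<in> Basis"
  shows "(\<lambda>x. g x \<bullet> i) \<in> L2 \<Omega>"
proof -
  have "integrable (lebesgue_on \<Omega>) (\<lambda>x. (norm (g x \<bullet> i))\<^sup>2)"
  proof (rule Bochner_Integration.integrable_bound[OF L2_square_integrable[OF assms(1)]])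
    show "(\<lambda>x. (norm (g x \<bullet> i))\<^sup>2) \<in> borel_measurable (lebesgue_on \<Omega>)"
      using L2_measurable[OF assms(1)] by measurable
    have "(norm (g x \<bullet> i))\<^sup>2 \<le> (norm (g x))\<^sup>2" for x
      using Basis_le_norm[OF assms(2)] by (intro power_mono) auto
    then show "AE x in lebesgue_on \<Omega>. norm ((norm (g x \<bullet> i))\<^sup>2) \<le> norm ((norm (g x))\<^sup>2)"
      by (intro AE_I2) simp
  qed
  moreover have "(\<lambda>x. g x \<bullet> i) \<in> borel_measurable (lebesgue_on \<Omega>)"
    using L2_measurable[OF assms(1)] by measurable
  ultimately show ?thesis by (simp add: L2_def)
qed

text \<open>The weighted arithmetic-geometric mean inequality
  \<open>2 a b \<le> e a\<^sup>2 + b\<^sup>2 / e\<close>, with \<open>e\<close> adapted to the fixed function \<open>q\<close>.\<close>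

lemma L2_tendsto_imp_product_tendsto:
  assumes q: "q \<in> L2 \<Omega>" and p: "\<And>j::nat. p j \<in> L2 \<Omega>"
    and lim: "(\<lambda>j. LINT x|lebesgue_on \<Omega>. (norm (p j x))\<^sup>2) \<longlonglongrightarrow> 0"
  shows "(\<lambda>j. LINT x|lebesgue_on \<Omega>. norm (q x) * norm (p j x)) \<longlonglongrightarrow> 0"
proof (rule LIMSEQ_I)
  fix r :: real assume r: "r > 0"
  define Q where "Q = (LINT x|lebesgue_on \<Omega>. (norm (q x))\<^sup>2)"
  have Q: "Q \<ge> 0" unfolding Q_def by (intro integral_nonneg_AE) auto
  define e where "e = r / (Q + 1)"
  have e: "e > 0" using r Q by (simp add: e_def)
  have eQ: "e * Q < r" using r Q by (simp add: e_def field_simps)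
  obtain N where N: "\<And>j. j \<ge> N \<Longrightarrow> norm ((LINT x|lebesgue_on \<Omega>. (norm (p j x))\<^sup>2) - 0) < e * r"
    using LIMSEQ_D[OF lim, of "e * r"] e r by auto
  have "norm ((LINT x|lebesgue_on \<Omega>. norm (q x) * norm (p j x)) - 0) < r" if "j \<ge> N" for j
  proof -
    define P where "P = (LINT x|lebesgue_on \<Omega>. (norm (p j x))\<^sup>2)"
    have young: "s * t \<le> (e * s\<^sup>2 + t\<^sup>2 / e) / 2" for s t :: real
    proof -
      have "0 \<le> (e * s - t)\<^sup>2 / e" using e by simp
      also have "\<dots> = e * s\<^sup>2 + t\<^sup>2 / e - 2 * (s * t)"
        using e by (simp add: field_simps power2_eq_square)
      finally show ?thesis by simp
    qed
    have "(LINT x|lebesgue_on \<Omega>. norm (q x) * norm (p j x))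
        \<le> (LINT x|lebesgue_on \<Omega>. (e * (norm (q x))\<^sup>2 + (norm (p j x))\<^sup>2 / e) / 2)"
      using L2_square_integrable[OF q] L2_square_integrable[OF p]
      by (intro integral_mono integrable_norm_mult_L2 q p young) auto
    also have "\<dots> = (e * Q + P / e) / 2"
      using L2_square_integrable[OF q] L2_square_integrable[OF p] by (simp add: Q_def P_def)
    also have "\<dots> < r"
    proof -
      have "P < e * r" using N[OF that] by (simp add: P_def)
      then have "P / e < r" using e by (simp add: field_simps)
      with eQ show ?thesis by simp
    qed
    finally have "(LINT x|lebesgue_on \<Omega>. norm (q x) * norm (p j x)) < r" .
    moreover have "0 \<le> (LINT x|lebesgue_on \<Omega>. norm (q x) * norm (p j x))"
      by (intro integral_nonneg_AE) auto
    ultimately show ?thesis by simp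
  qed
  then show "\<exists>N. \<forall>j\<ge>N. norm ((LINT x|lebesgue_on \<Omega>. norm (q x) * norm (p j x)) - 0) < r" by blast
qed

section \<open>The fundamental lemma of the calculus of variations\<close>

lemma open_eq_Union_balls:
  fixes U :: "'a::euclidean_space set"
  assumes "open U" "U \<noteq> {}"
  obtains c r where "\<And>n::nat. r n > 0" "\<And>n. cball (c n) (r n) \<subseteq> U" "U = (\<Union>n. ball (c n) (r n))"
proof -
  define F where "F = {ball x d |x d. d > 0 \<and> cball x d \<subseteq> U}"
  obtain G where G: "G \<subseteq> F" "countable G" "\<Union>G = \<Union>F"
    by (rule Lindelof[of F]) (auto simp: F_def)
  have "\<Union>F = U"
  proof
    show "\<Union>F \<subseteq> U" using ball_subset_cball by (fastforce simp: F_def)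
    show "U \<subseteq> \<Union>F"
    proof
      fix x assume "x \<in> U"
      then obtain d where "d > 0" "cball x d \<subseteq> U"
        using assms(1) open_contains_cball by blast
      then show "x \<in> \<Union>F" by (auto simp: F_def intro!: exI[of _ "ball x d"])
    qed
  qed
  then have "G \<noteq> {}" using assms(2) G(3) by auto
  define b where "b = from_nat_into G"
  have b: "b n \<in> F" for n using G(1) from_nat_into[OF \<open>G \<noteq> {}\<close>] by (auto simp: b_def)
  then have "\<exists>x d. b n = ball x d \<and> d > 0 \<and> cball x d \<subseteq> U" for n
    by (auto simp: F_def)
  then obtain c r where cr: "\<And>n. b n = ball (c n) (r n) \<and> r n > 0 \<and> cball (c n) (r n) \<subseteq> U"
    by metis
  have "U = (\<Union>n. b n)"
    using \<open>\<Union>F = U\<close> G(3) range_from_nat_into[OF \<open>G \<noteq> {}\<close> G(2)] by (simp add: b_def)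
  then have "U = (\<Union>n. ball (c n) (r n))" using cr by simp
  then show ?thesis using cr that[of r c] by blast
qed

text \<open>For balls \<open>B\<^sub>n\<close> exhausting the open set, let \<open>h\<close> be the sum of smooth bumps over
  \<open>B\<^sub>0, \<dots>, B\<^sub>m\<^sub>-\<^sub>1\<close>. Then \<open>1 - exp (- m h)\<close> lies in \<open>[0, 1]\<close>, vanishes off a finite
  union of compact balls, and tends to one at each point of the set.\<close>

lemma indicator_open_limit_of_test_functions:
  fixes U :: "'a::euclidean_space set"
  assumes U: "open U"
  obtains S where "\<And>m::nat. S m \<in> test_functions U" "\<And>m x. \<bar>S m x\<bar> \<le> 1"
    "\<And>x. (\<lambda>m. S m x) \<longlonglongrightarrow> indicator U x"
proof (cases "U = {}")
  case True
  then show ?thesis using that[of "\<lambda>m x. 0"] by (simp add: test_functions_zero)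
next
  case False
  obtain c :: "nat \<Rightarrow> 'a" and r :: "nat \<Rightarrow> real" where r: "\<And>n. r n > 0" and c: "\<And>n. cball (c n) (r n) \<subseteq> U"
    and Ueq: "U = (\<Union>n. ball (c n) (r n))"
    by (rule open_eq_Union_balls[OF U False]) blast
  define H where "H n x = flat ((r n)\<^sup>2 - (norm (x - c n))\<^sup>2)" for n x
  have H0: "H n x \<ge> 0" for n x by (simp add: H_def flat_nonneg)
  have Hpos: "H n x > 0 \<longleftrightarrow> x \<in> ball (c n) (r n)" for n x
  proof -
    have "H n x > 0 \<longleftrightarrow> (norm (x - c n))\<^sup>2 < (r n)\<^sup>2"
      using flat_pos[of "(r n)\<^sup>2 - (norm (x - c n))\<^sup>2"] flat_nonpos[of "(r n)\<^sup>2 - (norm (x - c n))\<^sup>2"]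
      by (auto simp: H_def) (meson diff_gt_0_iff_gt less_irrefl not_less)
    also have "\<dots> \<longleftrightarrow> norm (x - c n) < r n"
      using r[of n] by (metis less_imp_le norm_ge_zero power2_less_imp_less power_strict_mono pos2)
    finally show ?thesis by (simp add: dist_norm norm_minus_commute)
  qed
  define h where "h m x = (\<Sum>n<m. H n x)" for m x
  have h0: "h m x \<ge> 0" for m x by (simp add: h_def H0 sum_nonneg)
  define S where "S m x = 1 - exp (- (real m * h m x))" for m x
  have smH: "smooth_on (H n) UNIV" for n
    unfolding H_def by (intro smooth_on_flat smooth_on_diff smooth_on_const smooth_on_norm_square)
  have smS: "smooth_on (S m) UNIV" for m
    unfolding S_def h_def
    by (intro smooth_on_diff smooth_on_exp smooth_on_uminus smooth_on_cmult smooth_on_sum smooth_on_const smH)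
  show ?thesis
  proof (rule that[of S])
    fix m
    have sub: "closure {x. S m x \<noteq> 0} \<subseteq> (\<Union>n<m. cball (c n) (r n))"
    proof (rule closure_minimal)
      show "closed (\<Union>n<m. cball (c n) (r n))" by (intro closed_UN) auto
      show "{x. S m x \<noteq> 0} \<subseteq> (\<Union>n<m. cball (c n) (r n))"
      proof
        fix x assume "x \<in> {x. S m x \<noteq> 0}"
        then have "h m x \<noteq> 0" by (auto simp: S_def)
        then obtain n where "n < m" "H n x \<noteq> 0" unfolding h_def by (metis lessThan_iff sum.neutral)
        then show "x \<in> (\<Union>n<m. cball (c n) (r n))"
          using Hpos[of n x] H0[of n x] by (auto simp: less_eq_real_def)
      qed
    qed
    moreover have "compact (\<Union>n<m. cball (c n) (r n))" by (intro compact_UN) auto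
    ultimately have "compact (closure {x. S m x \<noteq> 0})"
      using compact_Int_closed[of "\<Union>n<m. cball (c n) (r n)" "closure {x. S m x \<noteq> 0}"]
      by (simp add: inf.absorb2)
    then show "S m \<in> test_functions U"
      using sub c smS by (auto simp: test_functions_def)
  next
    fix m x
    show "\<bar>S m x\<bar> \<le> 1" using h0[of m x] by (simp add: S_def)
  next
    fix x
    show "(\<lambda>m. S m x) \<longlonglongrightarrow> indicator U x"
    proof (cases "x \<in> U")
      case True
      then obtain n where n: "H n x > 0" using Ueq Hpos by auto
      have "filterlim (\<lambda>m. real m * h m x) at_top sequentially"
      proof (rule filterlim_at_top_mono)
        show "filterlim (\<lambda>m. real m * H n x) at_top sequentially"
          using n by (intro filterlim_at_top_mult_tendsto_pos[OF tendsto_const _ filterlim_real_sequentially])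
        show "\<forall>\<^sub>F m in sequentially. real m * H n x \<le> real m * h m x"
          using eventually_gt_at_top[of n]
        proof eventually_elim
          case (elim m)
          then have "H n x \<le> h m x" unfolding h_def by (intro member_le_sum H0) auto
          then show ?case by (intro mult_left_mono) auto
        qed
      qed
      then have "(\<lambda>m. exp (- (real m * h m x))) \<longlonglongrightarrow> 0"
        by (intro filterlim_compose[OF exp_at_bot] filterlim_compose[OF filterlim_uminus_at_bot_at_top])
      then have "(\<lambda>m. 1 - exp (- (real m * h m x))) \<longlonglongrightarrow> 1 - 0" by (intro tendsto_intros)
      then show ?thesis using True by (simp add: S_def)
    next
      case False
      then have "H n x = 0" for n using Hpos[of n x] H0[of n x] Ueq by (auto simp: less_eq_real_def)
      then show ?thesis using False by (simp add: S_def h_def)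
    qed
  qed
qed

lemma test_functions_mono: "U \<subseteq> \<Omega> \<Longrightarrow> test_functions U \<subseteq> test_functions \<Omega>"
  by (auto simp: test_functions_def)

text \<open>Indicators of open sets are bounded limits of test functions, and every measurable set is a
  countable intersection of open sets up to a null set.\<close>

lemma fundamental_lemma:
  fixes g :: "'a::euclidean_space \<Rightarrow> real"
  assumes \<Omega>: "open \<Omega>" "bounded \<Omega>" and g: "integrable (lebesgue_on \<Omega>) g"
    and zero: "\<And>\<phi>. \<phi> \<in> test_functions \<Omega> \<Longrightarrow> (LINT x|lebesgue_on \<Omega>. g x * \<phi> x) = 0"
  shows "AE x in lebesgue_on \<Omega>. g x = 0"
proof -
  let ?M = "lebesgue_on \<Omega>"
  interpret finite_measure ?M
    by (rule finite_measure_lebesgue_on) (simp add: \<Omega> lmeasurable_open)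
  have gm [measurable]: "g \<in> borel_measurable ?M" using g by simp
  have limit_zero: "(LINT x|?M. g x * T x) = 0"
    if T: "\<And>x. (\<lambda>n. s n x) \<longlonglongrightarrow> T x" and s: "\<And>n x. \<bar>s n x\<bar> \<le> 1"
      and m [measurable]: "\<And>n::nat. s n \<in> borel_measurable ?M" "T \<in> borel_measurable ?M" and z: "\<And>n. (LINT x|?M. g x * s n x) = 0"
    for s T
  proof -
    have "(\<lambda>n. LINT x|?M. g x * s n x) \<longlonglongrightarrow> (LINT x|?M. g x * T x)"
    proof (rule integral_dominated_convergence[where w = "\<lambda>x. \<bar>g x\<bar>"])
      show "integrable ?M (\<lambda>x. \<bar>g x\<bar>)" using g by simp
      show "AE x in ?M. (\<lambda>n. g x * s n x) \<longlonglongrightarrow> g x * T x"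
        by (intro AE_I2 tendsto_intros T)
      show "AE x in ?M. norm (g x * s n x) \<le> \<bar>g x\<bar>" for n
        using s by (intro AE_I2) (simp add: abs_mult mult_left_le)
    qed measurable
    then show ?thesis unfolding z by (simp add: LIMSEQ_const_iff)
  qed
  have ind_meas: "indicator (U::'a set) \<in> borel_measurable ?M" if "U \<in> sets borel" for U :: "'a set"
    using that by (intro borel_imp_lebesgue_on borel_measurable_indicator)
  have opn: "(LINT x|?M. g x * indicator U x) = 0" if U: "open U" "U \<subseteq> \<Omega>" for U
  proof -
    obtain S where S: "\<And>m. S m \<in> test_functions U" "\<And>m x. \<bar>S m x\<bar> \<le> 1"
      "\<And>x. (\<lambda>m. S m x) \<longlonglongrightarrow> indicator U x"
      by (rule indicator_open_limit_of_test_functions[OF U(1)]) blast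
    show ?thesis
    proof (rule limit_zero[of S, OF S(3,2)])
      show "S m \<in> borel_measurable ?M" for m
        by (rule smooth_on_measurable_lebesgue_on[OF test_functions_smooth[OF S(1)]])
      show "indicator U \<in> borel_measurable ?M"
        by (rule ind_meas) (simp add: U)
      show "(LINT x|?M. g x * S m x) = 0" for m
        using S(1) test_functions_mono[OF U(2)] by (intro zero) blast
    qed
  qed
  show ?thesis
  proof (rule density_zero[OF g])
    fix A assume "A \<in> sets ?M"
    then have A: "A \<in> sets lebesgue" "A \<subseteq> \<Omega>"
      using \<Omega> by (auto simp: sets_restrict_space_iff)
    obtain C T where CT: "gdelta C" "T \<in> null_sets lebesgue" "A \<union> T = C"
      using lebesgue_set_almost_gdelta[OF A(1)] by metis
    obtain V where V: "\<And>n::nat. open (V n)" "C = (\<Inter>n. V n)"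
      using CT(1) by (auto elim!: gdelta.cases)
    define W where "W n = \<Omega> \<inter> (\<Inter>i\<le>n. V i)" for n
    have W: "open (W n)" "W n \<subseteq> \<Omega>" for n
      using \<Omega> V(1) by (auto simp: W_def intro!: open_Int open_INT)
    have lim: "(\<lambda>n. indicator (W n) x :: real) \<longlonglongrightarrow> indicator (\<Omega> \<inter> C) x" for x
    proof (cases "x \<in> \<Omega> \<inter> C")
      case True
      then have "x \<in> W n" for n using V(2) by (auto simp: W_def)
      then show ?thesis using True by simp
    next
      case False
      have "\<exists>k. \<forall>n\<ge>k. x \<notin> W n"
      proof (cases "x \<in> \<Omega>")
        case True
        with False V(2) obtain k where "x \<notin> V k" by auto
        then show ?thesis by (auto simp: W_def)
      qed (auto simp: W_def)
      then obtain k where "\<And>n. n \<ge> k \<Longrightarrow> x \<notin> W n" by blast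
      then have "\<forall>\<^sub>F n in sequentially. (indicator (W n) x :: real) = indicator (\<Omega> \<inter> C) x"
        using False by (auto simp: eventually_sequentially intro!: exI[of _ k])
      then show ?thesis by (rule tendsto_eventually)
    qed
    have Cb: "\<Omega> \<inter> C \<in> sets borel"
      using \<Omega> V by auto
    have "(LINT x|?M. g x * indicator (\<Omega> \<inter> C) x) = 0"
    proof (rule limit_zero[of "\<lambda>n. indicator (W n)", OF lim])
      show "\<bar>indicator (W n) x :: real\<bar> \<le> 1" for n x by (simp add: indicator_def)
      show "indicator (W n) \<in> borel_measurable ?M" for n by (rule ind_meas) (simp add: W)
      show "indicator (\<Omega> \<inter> C) \<in> borel_measurable ?M" by (rule ind_meas[OF Cb])
      show "(LINT x|?M. g x * indicator (W n) x) = 0" for n by (rule opn[OF W])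
    qed
    moreover have "(LINT x|?M. g x * indicator (\<Omega> \<inter> C) x) = (LINT x|?M. g x * indicator A x)"
    proof (rule integral_cong_AE)
      have "T \<inter> \<Omega> \<in> null_sets ?M"
        using CT(2) \<Omega> by (simp add: null_sets_restrict_space null_set_Int2)
      then have "AE x in ?M. x \<notin> T \<inter> \<Omega>" by (rule AE_not_in)
      then show "AE x in ?M. g x * indicator (\<Omega> \<inter> C) x = g x * indicator A x"
        using AE_space
      proof eventually_elim
        case (elim x)
        then show ?case using CT(3) by (auto simp: indicator_def)
      qed
      show "(\<lambda>x. g x * indicator (\<Omega> \<inter> C) x) \<in> borel_measurable ?M"
        by (intro borel_measurable_times gm ind_meas Cb)
      show "(\<lambda>x. g x * indicator A x) \<in> borel_measurable ?M"
        using \<open>A \<in> sets ?M\<close> by measurable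
    qed
    ultimately show "set_lebesgue_integral ?M A g = 0"
      by (simp add: set_lebesgue_integral_def mult.commute)
  qed
qed

section \<open>Weak gradients\<close>

lemma weak_gradient_unique:
  assumes "open \<Omega>" "bounded \<Omega>" "g \<in> L2 \<Omega>" "g' \<in> L2 \<Omega>"
    and "has_weak_gradient \<Omega> u g" "has_weak_gradient \<Omega> u g'"
  shows "AE x in lebesgue_on \<Omega>. g x = g' x"
proof -
  have "AE x in lebesgue_on \<Omega>. (g x - g' x) \<bullet> i = 0" if i: "i \<in> Basis" for i
  proof (rule fundamental_lemma[OF assms(1,2)])
    have gi: "(\<lambda>x. g x \<bullet> i) \<in> L2 \<Omega>" "(\<lambda>x. g' x \<bullet> i) \<in> L2 \<Omega>"
      using assms i by (auto intro: L2_inner_Basis)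
    have one: "(\<lambda>x. 1::real) \<in> L2 \<Omega>"
      using assms by (intro L2_continuous) auto
    show "integrable (lebesgue_on \<Omega>) (\<lambda>x. (g x - g' x) \<bullet> i)"
      using integrable_mult_L2[OF gi(1) one] integrable_mult_L2[OF gi(2) one] by (simp add: inner_diff_left)
    fix \<phi> assume \<phi>: "\<phi> \<in> test_functions \<Omega>"
    then have \<phi>2: "\<phi> \<in> L2 \<Omega>"
      using assms by (intro L2_smooth test_functions_smooth)
    have "(LINT x|lebesgue_on \<Omega>. (g x - g' x) \<bullet> i * \<phi> x) =
        (LINT x|lebesgue_on \<Omega>. (g x \<bullet> i) * \<phi> x) - (LINT x|lebesgue_on \<Omega>. (g' x \<bullet> i) * \<phi> x)"
      using integrable_mult_L2[OF gi(1) \<phi>2] integrable_mult_L2[OF gi(2) \<phi>2]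
      by (simp add: inner_diff_left left_diff_distrib)
    also have "\<dots> = 0"
      using assms(5,6)[unfolded has_weak_gradient_def, rule_format, OF \<phi> i] by linarith
    finally show "(LINT x|lebesgue_on \<Omega>. (g x - g' x) \<bullet> i * \<phi> x) = 0" .
  qed
  then have "AE x in lebesgue_on \<Omega>. \<forall>i\<in>Basis. (g x - g' x) \<bullet> i = 0"
    by (intro AE_finite_allI) auto
  then show ?thesis
    by eventually_elim (auto simp: inner_diff_left intro: euclidean_eqI)
qed

lemma weak_gradient_L2: "u \<in> H1 \<Omega> \<Longrightarrow> weak_gradient \<Omega> u \<in> L2 \<Omega>"
  and has_weak_gradient_weak_gradient: "u \<in> H1 \<Omega> \<Longrightarrow> has_weak_gradient \<Omega> u (weak_gradient \<Omega> u)"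
proof -
  assume "u \<in> H1 \<Omega>"
  then have "\<exists>g. g \<in> L2 \<Omega> \<and> has_weak_gradient \<Omega> u g"
    by (auto simp: H1_def)
  then have "weak_gradient \<Omega> u \<in> L2 \<Omega> \<and> has_weak_gradient \<Omega> u (weak_gradient \<Omega> u)"
    unfolding weak_gradient_def by (rule someI_ex)
  then show "weak_gradient \<Omega> u \<in> L2 \<Omega>" "has_weak_gradient \<Omega> u (weak_gradient \<Omega> u)" by auto
qed

lemma weak_gradient_AE_eq:
  assumes "open \<Omega>" "bounded \<Omega>" "u \<in> L2 \<Omega>" "g \<in> L2 \<Omega>" "has_weak_gradient \<Omega> u g"
  shows "AE x in lebesgue_on \<Omega>. weak_gradient \<Omega> u x = g x"
proof (rule weak_gradient_unique[OF assms(1,2) weak_gradient_L2 assms(4) has_weak_gradient_weak_gradient assms(5)])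
  show "u \<in> H1 \<Omega>" "u \<in> H1 \<Omega>" using assms by (auto simp: H1_def)
qed

lemma has_weak_gradient_grad:
  assumes "open \<Omega>" "bounded \<Omega>" "smooth_on w UNIV"
  shows "has_weak_gradient \<Omega> w (grad w)"
  unfolding has_weak_gradient_def using assms by (simp add: grad_inner_Basis integration_by_parts)

lemma has_weak_gradient_diff:
  assumes \<Omega>: "open \<Omega>" "bounded \<Omega>" and L2: "u \<in> L2 \<Omega>" "v \<in> L2 \<Omega>" "g \<in> L2 \<Omega>" "k \<in> L2 \<Omega>"
    and "has_weak_gradient \<Omega> u g" "has_weak_gradient \<Omega> v k"
  shows "has_weak_gradient \<Omega> (\<lambda>x. u x - v x) (\<lambda>x. g x - k x)"
  unfolding has_weak_gradient_def
proof (intro ballI)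
  fix \<phi> and i :: 'a assume \<phi>: "\<phi> \<in> test_functions \<Omega>" and i: "i \<in> Basis"
  then have \<phi>2: "\<phi> \<in> L2 \<Omega>" "(\<lambda>x. frechet_derivative \<phi> (at x) i) \<in> L2 \<Omega>"
    using \<Omega> by (auto intro!: L2_smooth test_functions_smooth smooth_on_derivative)
  note int = integrable_mult_L2[OF L2(1) \<phi>2(2)] integrable_mult_L2[OF L2(2) \<phi>2(2)]
    integrable_mult_L2[OF L2_inner_Basis[OF L2(3) i] \<phi>2(1)]
    integrable_mult_L2[OF L2_inner_Basis[OF L2(4) i] \<phi>2(1)]
  have "(LINT x|lebesgue_on \<Omega>. u x * frechet_derivative \<phi> (at x) i) = - (LINT x|lebesgue_on \<Omega>. (g x \<bullet> i) * \<phi> x)"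
       "(LINT x|lebesgue_on \<Omega>. v x * frechet_derivative \<phi> (at x) i) = - (LINT x|lebesgue_on \<Omega>. (k x \<bullet> i) * \<phi> x)"
    using assms(7,8) \<phi> i by (auto simp: has_weak_gradient_def)
  then show "(LINT x|lebesgue_on \<Omega>. (u x - v x) * frechet_derivative \<phi> (at x) i) =
      - (LINT x|lebesgue_on \<Omega>. ((g x - k x) \<bullet> i) * \<phi> x)"
    using int by (simp add: left_diff_distrib inner_diff_left)
qed

lemma test_functions_subset_H1:
  assumes "open \<Omega>" "bounded \<Omega>" "\<phi> \<in> test_functions \<Omega>"
  shows "\<phi> \<in> H1 \<Omega>"
  using assms has_weak_gradient_grad[OF assms(1,2)] L2_smooth L2_grad test_functions_smooth
  by (fastforce simp: H1_def)

lemma test_functions_subset_H10: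
  assumes \<Omega>: "open \<Omega>" "bounded \<Omega>" and \<phi>: "\<phi> \<in> test_functions \<Omega>"
  shows "\<phi> \<in> H10 \<Omega>"
proof -
  have "AE x in lebesgue_on \<Omega>. weak_gradient \<Omega> (\<lambda>x. 0) x = 0"
    by (rule weak_gradient_AE_eq[OF \<Omega>]) (auto simp: L2_def has_weak_gradient_def)
  then have "(LINT x|lebesgue_on \<Omega>. (norm (weak_gradient \<Omega> (\<lambda>x. 0) x))\<^sup>2) = 0"
    by (intro integral_eq_zero_AE) auto
  then have "H1_norm \<Omega> (\<lambda>x. \<phi> x - \<phi> x) = 0"
    by (simp add: H1_norm_def)
  then show ?thesis
    using test_functions_subset_H1[OF assms] \<phi> by (auto simp: H10_def intro!: exI[of _ "\<lambda>k. \<phi>"])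
qed

text \<open>The convergence in the definition of \<^const>\<open>H10\<close> refers to the weak gradient of the
  differences; by uniqueness this is the difference of the gradients.\<close>

lemma H10_approximation:
  assumes \<Omega>: "open \<Omega>" "bounded \<Omega>" and u: "u \<in> H10 \<Omega>"
  obtains \<phi> where "\<And>j::nat. \<phi> j \<in> test_functions \<Omega>"
    "(\<lambda>j. LINT x|lebesgue_on \<Omega>. (norm (u x - \<phi> j x))\<^sup>2) \<longlonglongrightarrow> 0"
    "(\<lambda>j. LINT x|lebesgue_on \<Omega>. (norm (weak_gradient \<Omega> u x - grad (\<phi> j) x))\<^sup>2) \<longlonglongrightarrow> 0"
proof -
  let ?M = "lebesgue_on \<Omega>"
  obtain \<phi> where \<phi>: "\<And>j::nat. \<phi> j \<in> test_functions \<Omega>"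
    and lim: "(\<lambda>j. H1_norm \<Omega> (\<lambda>x. u x - \<phi> j x)) \<longlonglongrightarrow> 0" and uH: "u \<in> H1 \<Omega>"
    using u by (auto simp: H10_def)
  have uL: "u \<in> L2 \<Omega>" using uH by (simp add: H1_def)
  define A where "A j = (LINT x|?M. (norm (u x - \<phi> j x))\<^sup>2)" for j
  define B where "B j = (LINT x|?M. (norm (weak_gradient \<Omega> u x - grad (\<phi> j) x))\<^sup>2)" for j
  have nn: "A j \<ge> 0" "B j \<ge> 0" for j
    unfolding A_def B_def by (intro integral_nonneg_AE; simp)+
  have norm_eq: "(H1_norm \<Omega> (\<lambda>x. u x - \<phi> j x))\<^sup>2 = A j + B j" for j
  proof -
    have \<phi>L: "\<phi> j \<in> L2 \<Omega>" "grad (\<phi> j) \<in> L2 \<Omega>"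
      using \<Omega> \<phi>[of j] by (auto intro: L2_smooth L2_grad test_functions_smooth)
    have gL: "(\<lambda>x. weak_gradient \<Omega> u x - grad (\<phi> j) x) \<in> L2 \<Omega>"
      by (rule L2_diff[OF weak_gradient_L2[OF uH] \<phi>L(2)])
    have dL: "(\<lambda>x. u x - \<phi> j x) \<in> L2 \<Omega>" by (rule L2_diff[OF uL \<phi>L(1)])
    have hw: "has_weak_gradient \<Omega> (\<lambda>x. u x - \<phi> j x) (\<lambda>x. weak_gradient \<Omega> u x - grad (\<phi> j) x)"
      by (rule has_weak_gradient_diff[OF \<Omega> uL \<phi>L(1) weak_gradient_L2[OF uH] \<phi>L(2)
            has_weak_gradient_weak_gradient[OF uH] has_weak_gradient_grad[OF \<Omega> test_functions_smooth[OF \<phi>]]])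
    have "(\<lambda>x. u x - \<phi> j x) \<in> H1 \<Omega>" using dL gL hw by (auto simp: H1_def)
    then have wL: "weak_gradient \<Omega> (\<lambda>x. u x - \<phi> j x) \<in> L2 \<Omega>" by (rule weak_gradient_L2)
    have ae: "AE x in ?M. weak_gradient \<Omega> (\<lambda>x. u x - \<phi> j x) x = weak_gradient \<Omega> u x - grad (\<phi> j) x"
      by (rule weak_gradient_AE_eq[OF \<Omega> dL gL hw])
    have "(LINT x|?M. (norm (weak_gradient \<Omega> (\<lambda>x. u x - \<phi> j x) x))\<^sup>2) = B j"
      unfolding B_def
    proof (rule integral_cong_AE)
      show "AE x in ?M. (norm (weak_gradient \<Omega> (\<lambda>x. u x - \<phi> j x) x))\<^sup>2
          = (norm (weak_gradient \<Omega> u x - grad (\<phi> j) x))\<^sup>2"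
        using ae by eventually_elim simp
    qed (use L2_measurable[OF wL] L2_measurable[OF gL] in measurable)
    then show ?thesis
      using nn[of j] by (simp add: H1_norm_def A_def)
  qed
  have sq: "(\<lambda>j. A j + B j) \<longlonglongrightarrow> 0"
    using tendsto_power[OF lim, of 2] by (simp add: norm_eq)
  have "A \<longlonglongrightarrow> 0" "B \<longlonglongrightarrow> 0"
    by (rule tendsto_sandwich[OF _ _ tendsto_const sq]; use nn in simp)+
  then show ?thesis using that[OF \<phi>] by (simp add: A_def[abs_def] B_def[abs_def])
qed

lemma weak_solution_test:
  assumes \<Omega>: "open \<Omega>" "bounded \<Omega>" and u: "weak_solution \<Omega> lam f u" and \<phi>: "\<phi> \<in> test_functions \<Omega>"
  shows "(LINT x|lebesgue_on \<Omega>. weak_gradient \<Omega> u x \<bullet> grad \<phi> x) = lam * (LINT x|lebesgue_on \<Omega>. f (u x) * \<phi> x)"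
proof -
  note sm = test_functions_smooth[OF \<phi>]
  have H: "\<phi> \<in> H1 \<Omega>" "\<phi> \<in> H10 \<Omega>"
    using test_functions_subset_H1[OF \<Omega> \<phi>] test_functions_subset_H10[OF \<Omega> \<phi>] by auto
  have uH: "u \<in> H1 \<Omega>" using u by (auto simp: weak_solution_def H10_def)
  have ae: "AE x in lebesgue_on \<Omega>. weak_gradient \<Omega> \<phi> x = grad \<phi> x"
    by (rule weak_gradient_AE_eq[OF \<Omega> L2_smooth[OF \<Omega> sm] L2_grad[OF \<Omega> sm] has_weak_gradient_grad[OF \<Omega> sm]])
  have "(LINT x|lebesgue_on \<Omega>. weak_gradient \<Omega> u x \<bullet> grad \<phi> x)
      = (LINT x|lebesgue_on \<Omega>. weak_gradient \<Omega> u x \<bullet> weak_gradient \<Omega> \<phi> x)"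
  proof (rule integral_cong_AE)
    show "AE x in lebesgue_on \<Omega>. weak_gradient \<Omega> u x \<bullet> grad \<phi> x = weak_gradient \<Omega> u x \<bullet> weak_gradient \<Omega> \<phi> x"
      using ae by eventually_elim simp
  qed (use L2_measurable[OF weak_gradient_L2[OF uH]] L2_measurable[OF weak_gradient_L2[OF H(1)]]
        L2_measurable[OF L2_grad[OF \<Omega> sm]] in measurable)
  also have "\<dots> = lam * (LINT x|lebesgue_on \<Omega>. f (u x) * \<phi> x)"
    using u H(2) by (auto simp: weak_solution_def)
  finally show ?thesis .
qed

section \<open>Comparison with smooth supersolutions\<close>

lemma Green_formula_test:
  assumes \<Omega>: "open \<Omega>" "bounded \<Omega>" and w: "smooth_on w UNIV" and \<phi>: "\<phi> \<in> test_functions \<Omega>"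
  shows "(LINT x|lebesgue_on \<Omega>. grad w x \<bullet> grad \<phi> x) = - (LINT x|lebesgue_on \<Omega>. laplacian w x * \<phi> x)"
proof -
  let ?w = "\<lambda>i x. frechet_derivative w (at x) i" and ?p = "\<lambda>i x. frechet_derivative \<phi> (at x) i"
  note sm = test_functions_smooth[OF \<phi>]
  have int: "integrable (lebesgue_on \<Omega>) (\<lambda>x. ?w i x * ?p i x)"
    "integrable (lebesgue_on \<Omega>) (\<lambda>x. frechet_derivative (?w i) (at x) i * \<phi> x)" for i
    using \<Omega> w sm by (auto intro!: integrable_mult_L2 L2_smooth smooth_on_derivative)
  have "grad w x \<bullet> grad \<phi> x = (\<Sum>i\<in>Basis. ?w i x * ?p i x)" for x
    by (subst euclidean_inner) (simp add: grad_inner_Basis)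
  then have "(LINT x|lebesgue_on \<Omega>. grad w x \<bullet> grad \<phi> x) = (\<Sum>i\<in>Basis. LINT x|lebesgue_on \<Omega>. ?w i x * ?p i x)"
    using int by simp
  also have "\<dots> = (\<Sum>i\<in>Basis. - (LINT x|lebesgue_on \<Omega>. frechet_derivative (?w i) (at x) i * \<phi> x))"
    by (intro sum.cong refl integration_by_parts \<Omega> smooth_on_derivative w \<phi>)
  also have "\<dots> = - (LINT x|lebesgue_on \<Omega>. laplacian w x * \<phi> x)"
    using int by (simp add: laplacian_def sum_distrib_right sum_negf)
  finally show ?thesis .
qed

text \<open>
  The hypotheses on \<open>\<phi>\<close> say that \<open>u\<close> lies in the closure of the test functions with gradient
  \<open>P\<close>; in this form the principle applies to \<open>- u\<close> without computing its weak gradient.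
  With \<open>q = P - grad v\<close> and \<open>p\<^sub>j = P - grad \<phi>\<^sub>j\<close>, testing the equation with \<open>G (\<phi>\<^sub>j - v)\<close>, where \<open>G\<close> is \<open>flat\<close>, gives
  \<open>\<integral> (F + laplacian v) G (\<phi>\<^sub>j - v) = \<integral> G' (\<phi>\<^sub>j - v) q \<bullet> (q - p\<^sub>j) \<ge> - 2 \<integral> \<bar>q\<bar> \<bar>p\<^sub>j\<bar>\<close>,
  since \<open>0 \<le> G' \<le> 2\<close>. The right-hand side tends to zero, so
  \<open>\<integral> (F + laplacian v) G (u - v) \<ge> 0\<close>, although \<open>F + laplacian v < 0\<close> where \<open>G (u - v) > 0\<close>.
  By the strict inequality \<open>G (u - v)\<close> must then vanish almost everywhere.
\<close>

lemma comparison_principle: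
  fixes u v F :: "'a::euclidean_space \<Rightarrow> real"
  assumes \<Omega>: "open \<Omega>" "bounded \<Omega>"
    and L2: "u \<in> L2 \<Omega>" "P \<in> L2 \<Omega>" "F \<in> L2 \<Omega>"
    and \<phi>: "\<And>j::nat. \<phi> j \<in> test_functions \<Omega>"
    and lim: "(\<lambda>j. LINT x|lebesgue_on \<Omega>. (norm (u x - \<phi> j x))\<^sup>2) \<longlonglongrightarrow> 0"
      "(\<lambda>j. LINT x|lebesgue_on \<Omega>. (norm (P x - grad (\<phi> j) x))\<^sup>2) \<longlonglongrightarrow> 0"
    and eqn: "\<And>\<psi>. \<psi> \<in> test_functions \<Omega> \<Longrightarrow>
      (LINT x|lebesgue_on \<Omega>. P x \<bullet> grad \<psi> x) = (LINT x|lebesgue_on \<Omega>. F x * \<psi> x)"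
    and v: "smooth_on v UNIV" "\<And>x. 0 \<le> v x"
    and super: "AE x in lebesgue_on \<Omega>. v x < u x \<longrightarrow> F x < - laplacian v x"
  shows "AE x in lebesgue_on \<Omega>. u x \<le> v x"
proof -
  let ?M = "lebesgue_on \<Omega>"
  note sm = test_functions_smooth[OF \<phi>]
  define f where "f x = F x + laplacian v x" for x
  define q where "q x = P x - grad v x" for x
  define p where "p j x = P x - grad (\<phi> j) x" for j x
  define w where "w j x = \<phi> j x - v x" for j x
  define g where "g j x = flat (w j x)" for j x
  define G where "G x = flat (u x - v x)" for x
  have L: "f \<in> L2 \<Omega>" "q \<in> L2 \<Omega>" "p j \<in> L2 \<Omega>" "(\<lambda>x. u x - \<phi> j x) \<in> L2 \<Omega>" for j
    unfolding f_def q_def p_def using L2 \<Omega> v sm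
    by (auto intro!: L2_add L2_diff L2_smooth L2_grad smooth_on_laplacian)
  have smw: "smooth_on (w j) UNIV" for j
    unfolding w_def by (intro smooth_on_diff sm v)
  have smg: "smooth_on (g j) UNIV" for j
    unfolding g_def by (intro smooth_on_flat smw)
  \<comment> \<open>As \<open>v\<close> is nonnegative, \<open>g j\<close> vanishes wherever \<open>\<phi> j\<close> does, so its support is compact in \<open>\<Omega>\<close>.\<close>
  have g: "g j \<in> test_functions \<Omega>" for j
    by (rule test_functions_support[OF smg \<phi>[of j]]) (use v in \<open>auto simp: g_def w_def flat_nonpos\<close>)
  have gL: "g j \<in> L2 \<Omega>" for j by (rule L2_smooth[OF \<Omega> smg])
  have uv: "(\<lambda>x. u x - v x) \<in> L2 \<Omega>" by (intro L2_diff L2 L2_smooth \<Omega> v)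
  have flat_meas: "flat \<in> borel_measurable borel"
    by (intro borel_measurable_continuous_onI continuous_at_imp_continuous_on ballI DERIV_isCont)
       (rule flat_deriv_has_derivative)
  have GL: "G \<in> L2 \<Omega>"
  proof -
    have m: "G \<in> borel_measurable ?M"
      unfolding G_def using measurable_compose[OF L2_measurable[OF uv] flat_meas] by simp
    have "integrable ?M (\<lambda>x. (norm (G x))\<^sup>2)"
    proof (rule Bochner_Integration.integrable_bound)
      show "integrable ?M (\<lambda>x. 4 * (norm (u x - v x))\<^sup>2)"
        using L2_square_integrable[OF uv] by simp
      show "(\<lambda>x. (norm (G x))\<^sup>2) \<in> borel_measurable ?M" using m by measurable
      have "(norm (G x))\<^sup>2 \<le> (2 * \<bar>u x - v x\<bar>)\<^sup>2" for x
        using flat_lipschitz[of "u x - v x" 0] by (intro power_mono) (auto simp: G_def flat_nonpos)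
      then show "AE x in ?M. norm ((norm (G x))\<^sup>2) \<le> norm (4 * (norm (u x - v x))\<^sup>2)"
        by (intro AE_I2) (simp add: power_mult_distrib)
    qed
    with m show ?thesis by (simp add: L2_def)
  qed
  have energy: "- (2 * (LINT x|?M. norm (q x) * norm (p j x))) \<le> (LINT x|?M. f x * g j x)" for j
  proof -
    have eqn_j: "(LINT x|?M. f x * g j x) = (LINT x|?M. q x \<bullet> grad (g j) x)"
    proof -
      have "(LINT x|?M. f x * g j x) = (LINT x|?M. F x * g j x) + (LINT x|?M. laplacian v x * g j x)"
        unfolding f_def distrib_right
        by (intro Bochner_Integration.integral_add integrable_mult_L2 L2 gL L2_smooth \<Omega> smooth_on_laplacian v)
      also have "\<dots> = (LINT x|?M. P x \<bullet> grad (g j) x) - (LINT x|?M. grad v x \<bullet> grad (g j) x)"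
        using eqn[OF g] Green_formula_test[OF \<Omega> v(1) g] by simp
      also have "\<dots> = (LINT x|?M. q x \<bullet> grad (g j) x)"
        unfolding q_def inner_diff_left
        by (intro Bochner_Integration.integral_diff[symmetric] integrable_inner_L2 L2 L2_grad \<Omega> v smg)
      finally show ?thesis .
    qed
    have "- (2 * (norm (q x) * norm (p j x))) \<le> q x \<bullet> grad (g j) x" for x
    proof -
      define d where "d = flat_deriv (Suc 0) (w j x)"
      have d: "0 \<le> d" "d \<le> 2" unfolding d_def by (rule flat_slope_bounds)+
      have "grad (g j) x = d *\<^sub>R grad (w j) x"
        unfolding g_def d_def by (rule grad_compose_real[OF smw flat_deriv_has_derivative])
      also have "grad (w j) x = q x - p j x"
        unfolding w_def q_def p_def by (simp add: grad_diff sm v)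
      finally have "q x \<bullet> grad (g j) x = d * ((norm (q x))\<^sup>2 - q x \<bullet> p j x)"
        by (simp add: inner_diff_right power2_norm_eq_inner)
      moreover have "- (norm (q x) * norm (p j x)) \<le> (norm (q x))\<^sup>2 - q x \<bullet> p j x"
        using norm_cauchy_schwarz[of "q x" "p j x"] zero_le_power2[of "norm (q x)"] by linarith
      then have "d * (- (norm (q x) * norm (p j x))) \<le> d * ((norm (q x))\<^sup>2 - q x \<bullet> p j x)"
        using d by (intro mult_left_mono)
      moreover have "d * (norm (q x) * norm (p j x)) \<le> 2 * (norm (q x) * norm (p j x))"
        using d by (intro mult_right_mono) auto
      ultimately show ?thesis by simp
    qed
    then have "(LINT x|?M. - (2 * (norm (q x) * norm (p j x)))) \<le> (LINT x|?M. q x \<bullet> grad (g j) x)"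
      using integrable_norm_mult_L2[OF L(2,3)]
      by (intro integral_mono integrable_inner_L2 L L2_grad \<Omega> smg) auto
    then show ?thesis by (simp add: eqn_j)
  qed
  have conv: "(\<lambda>j. LINT x|?M. f x * g j x) \<longlonglongrightarrow> (LINT x|?M. f x * G x)"
  proof -
    have "(\<lambda>j. 2 * (LINT x|?M. norm (f x) * norm (u x - \<phi> j x))) \<longlonglongrightarrow> 2 * 0"
      by (intro tendsto_intros L2_tendsto_imp_product_tendsto L lim)
    then have lim0: "(\<lambda>j. 2 * (LINT x|?M. norm (f x) * norm (u x - \<phi> j x))) \<longlonglongrightarrow> 0"
      by simp
    have bound: "norm ((LINT x|?M. f x * g j x) - (LINT x|?M. f x * G x)) \<le> 2 * (LINT x|?M. norm (f x) * norm (u x - \<phi> j x))" for j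
    proof -
      have "(LINT x|?M. f x * g j x) - (LINT x|?M. f x * G x) = (LINT x|?M. f x * (g j x - G x))"
        using integrable_mult_L2[OF L(1) gL] integrable_mult_L2[OF L(1) GL] by (simp add: right_diff_distrib)
      also have "norm \<dots> \<le> (LINT x|?M. norm (f x * (g j x - G x)))" by (rule integral_norm_bound)
      also have "\<dots> \<le> (LINT x|?M. 2 * (norm (f x) * norm (u x - \<phi> j x)))"
      proof (rule integral_mono)
        show "integrable ?M (\<lambda>x. norm (f x * (g j x - G x)))"
          by (intro integrable_norm integrable_mult_L2 L L2_diff gL GL)
        show "integrable ?M (\<lambda>x. 2 * (norm (f x) * norm (u x - \<phi> j x)))"
          using integrable_norm_mult_L2[OF L(1,4)] by simp
        fix x
        have "\<bar>g j x - G x\<bar> \<le> 2 * \<bar>u x - \<phi> j x\<bar>"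
          using flat_lipschitz[of "w j x" "u x - v x"] by (simp add: g_def G_def w_def abs_minus_commute)
        then have "\<bar>f x\<bar> * \<bar>g j x - G x\<bar> \<le> \<bar>f x\<bar> * (2 * \<bar>u x - \<phi> j x\<bar>)"
          by (intro mult_left_mono) auto
        then show "norm (f x * (g j x - G x)) \<le> 2 * (norm (f x) * norm (u x - \<phi> j x))"
          by (simp add: abs_mult)
      qed
      finally show ?thesis by simp
    qed
    have "(\<lambda>j. (LINT x|?M. f x * g j x) - (LINT x|?M. f x * G x)) \<longlonglongrightarrow> 0"
      by (rule Lim_null_comparison[OF _ lim0], rule always_eventually, rule allI, rule bound)
    then show ?thesis by (simp add: LIM_zero_iff)
  qed
  have "(\<lambda>j. - (2 * (LINT x|?M. norm (q x) * norm (p j x)))) \<longlonglongrightarrow> - (2 * 0)"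
    by (intro tendsto_minus tendsto_mult_left L2_tendsto_imp_product_tendsto[OF L(2,3)])
       (use lim(2) in \<open>simp add: p_def\<close>)
  then have "- (2 * 0) \<le> (LINT x|?M. f x * G x)"
    by (rule LIMSEQ_le[OF _ conv]) (use energy in blast)
  then have ge: "0 \<le> (LINT x|?M. f x * G x)" by simp
  \<comment> \<open>The integrand \<open>f G\<close> is strictly negative wherever \<open>u > v\<close> and zero elsewhere.\<close>
  have sign: "AE x in ?M. 0 \<le> - (f x * G x)"
    using super
  proof eventually_elim
    case (elim x)
    then show ?case
      by (cases "v x < u x") (auto simp: f_def G_def flat_nonpos flat_nonneg mult_nonpos_nonneg)
  qed
  have int: "integrable ?M (\<lambda>x. - (f x * G x))"
    using integrable_mult_L2[OF L(1) GL] by simp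
  have "(LINT x|?M. - (f x * G x)) = 0"
    using ge integral_nonneg_AE[OF sign] by simp
  then have "AE x in ?M. - (f x * G x) = 0"
    using integral_nonneg_eq_0_iff_AE[OF int sign] by simp
  then show ?thesis
    using super
  proof eventually_elim
    case (elim x)
    show ?case
    proof (rule ccontr)
      assume "\<not> u x \<le> v x"
      then have "f x < 0" "G x > 0" using elim(2) flat_pos by (auto simp: f_def G_def)
      then show False using elim(1) by simp
    qed
  qed
qed

section \<open>An a priori bound for weak solutions\<close>

lemma laplacian_gaussian:
  fixes e :: "'a::euclidean_space"
  assumes e: "e \<in> Basis"
  shows "laplacian (\<lambda>x. c - d * exp (- (x \<bullet> e - T)\<^sup>2)) x = - (d * ((4 * (x \<bullet> e - T)\<^sup>2 - 2) * exp (- (x \<bullet> e - T)\<^sup>2)))"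
proof -
  have first: "frechet_derivative (\<lambda>x. c - d * exp (- (x \<bullet> e - T)\<^sup>2)) (at y) i
      = (i \<bullet> e) * (2 * d * (y \<bullet> e - T) * exp (- (y \<bullet> e - T)\<^sup>2))" for y i
    by (subst frechet_derivative_eqI) (auto intro!: derivative_eq_intros simp: algebra_simps)
  have second: "frechet_derivative (\<lambda>y. (i \<bullet> e) * (2 * d * (y \<bullet> e - T) * exp (- (y \<bullet> e - T)\<^sup>2))) (at x) i
      = (i \<bullet> e)\<^sup>2 * - (d * ((4 * (x \<bullet> e - T)\<^sup>2 - 2) * exp (- (x \<bullet> e - T)\<^sup>2)))" for i
    by (subst frechet_derivative_eqI)
       (auto intro!: derivative_eq_intros simp: algebra_simps power2_eq_square)
  have "(\<Sum>i\<in>Basis. (i \<bullet> e)\<^sup>2) = 1"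
    using e by (simp add: inner_Basis if_distrib[of "\<lambda>t. t\<^sup>2"] cong: if_cong)
  then show ?thesis
    unfolding laplacian_def first second sum_distrib_right[symmetric] by simp
qed

text \<open>
  The barriers are \<open>A - a \<psi>\<close> with the one-dimensional Gaussian \<open>\<psi>\<close> centred far outside \<open>\<Omega>\<close>.
  An exponential would also satisfy the differential inequality, but it is unbounded, whereas
  \<open>\<psi> \<le> 1\<close> keeps the barrier nonnegative everywhere. What matters in the conclusion is that \<open>d\<close> is
  chosen before \<open>A\<close> and \<open>b\<close>, so that \<open>A\<close> may then be taken within \<open>d\<close> of \<open>a\<close>.
\<close>

lemma weak_solution_bound_below_zero_level:
  fixes \<Omega> :: "'a::euclidean_space set"
  assumes \<Omega>: "open \<Omega>" "bounded \<Omega>"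
    and f: "continuous_on UNIV f" "\<And>s. 0 \<le> f s"
    and pos: "0 < a" "0 < K" "0 < C"
  obtains d where "d > 0"
    "\<And>A b lam u. a \<le> A \<Longrightarrow> b \<le> A \<Longrightarrow> 0 \<le> lam \<Longrightarrow> lam \<le> C \<Longrightarrow> weak_solution \<Omega> lam f u \<Longrightarrow>
      AE x in lebesgue_on \<Omega>. \<bar>u x\<bar> \<le> b \<Longrightarrow> (\<And>s. s \<le> b \<Longrightarrow> f s \<le> K * (A - s)) \<Longrightarrow>
      AE x in lebesgue_on \<Omega>. \<bar>u x\<bar> \<le> A - d"
proof -
  obtain e :: 'a where e: "e \<in> Basis" using nonempty_Basis by blast
  obtain R where R: "R > 0" "\<And>x. x \<in> \<Omega> \<Longrightarrow> norm x \<le> R"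
    using \<Omega>(2) bounded_pos by metis
  \<comment> \<open>On \<open>\<Omega>\<close> the distance \<open>t = T - x \<bullet> e\<close> is then at least \<open>C K + 1\<close>, whence
    \<open>\<Delta> \<psi> = (4 t\<^sup>2 - 2) \<psi> > C K \<psi>\<close>.\<close>
  define T where "T = R + C * K + 1"
  define \<psi> where "\<psi> x = exp (- (x \<bullet> e - T)\<^sup>2)" for x :: 'a
  define l where "l x = (4 * (x \<bullet> e - T)\<^sup>2 - 2) * \<psi> x" for x
  define d where "d = a * exp (- (2 * R + C * K + 1)\<^sup>2)"
  have \<psi>: "0 < \<psi> x" "\<psi> x \<le> 1" for x by (auto simp: \<psi>_def)
  have CK: "C * K > 0" using pos by simp
  have near: "C * K + 1 \<le> T - x \<bullet> e" "T - x \<bullet> e \<le> 2 * R + C * K + 1" if "x \<in> \<Omega>" for x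
    using R(2)[OF that] Basis_le_norm[OF e, of x] by (auto simp: T_def)
  have l: "C * K * \<psi> x < l x" if "x \<in> \<Omega>" for x
  proof -
    define t where "t = T - x \<bullet> e"
    have t: "C * K + 1 \<le> t" using near[OF that] by (simp add: t_def)
    have "1 * t \<le> t * t" using t CK by (intro mult_right_mono) auto
    then have "C * K < 4 * t\<^sup>2 - 2" using t CK unfolding power2_eq_square by linarith
    moreover have "(x \<bullet> e - T)\<^sup>2 = t\<^sup>2" by (simp add: t_def power2_commute)
    ultimately show ?thesis using \<psi>[of x] by (simp add: l_def)
  qed
  have \<psi>d: "d \<le> a * \<psi> x" if "x \<in> \<Omega>" for x
  proof -
    have "(T - x \<bullet> e)\<^sup>2 \<le> (2 * R + C * K + 1)\<^sup>2"
      using near[OF that] CK by (intro power_mono) auto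
    then show ?thesis using pos by (simp add: d_def \<psi>_def power2_commute)
  qed
  show ?thesis
  proof (rule that[of d])
    show "d > 0" using pos by (simp add: d_def)
    fix A b lam u
    assume A: "a \<le> A" "b \<le> A" and lam: "0 \<le> lam" "lam \<le> C" and u: "weak_solution \<Omega> lam f u"
      and ub: "AE x in lebesgue_on \<Omega>. \<bar>u x\<bar> \<le> b" and fb: "\<And>s. s \<le> b \<Longrightarrow> f s \<le> K * (A - s)"
    let ?M = "lebesgue_on \<Omega>"
    define F where "F x = lam * f (u x)" for x
    define P where "P = weak_gradient \<Omega> u"
    define v where "v x = A - a * \<psi> x" for x
    have uH: "u \<in> H10 \<Omega>" "u \<in> H1 \<Omega>" "u \<in> L2 \<Omega>"
      using u by (auto simp: weak_solution_def H10_def H1_def)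
    have PL: "P \<in> L2 \<Omega>" unfolding P_def by (rule weak_gradient_L2[OF uH(2)])
    have FL: "F \<in> L2 \<Omega>"
    proof -
      have "bounded (f ` {-b..b})"
        by (intro compact_imp_bounded compact_continuous_image continuous_on_subset[OF f(1)]) auto
      then obtain B where B: "\<And>s. s \<in> {-b..b} \<Longrightarrow> norm (f s) \<le> B"
        unfolding bounded_iff by blast
      have "AE x in ?M. norm (F x) \<le> C * B"
        using ub
      proof eventually_elim
        case (elim x)
        then have "norm (f (u x)) \<le> B" by (intro B) auto
        then have "lam * norm (f (u x)) \<le> C * B" using lam pos by (intro mult_mono) auto
        then show ?case using lam by (simp add: F_def abs_mult)
      qed
      moreover have "f \<in> borel_measurable borel" using f(1) by (rule borel_measurable_continuous_onI)
      then have "F \<in> borel_measurable ?M"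
        unfolding F_def
        by (intro borel_measurable_times borel_measurable_const measurable_compose[OF L2_measurable[OF uH(3)]])
      ultimately show ?thesis by (intro L2_bounded \<Omega>)
    qed
    have eqn: "(LINT x|?M. P x \<bullet> grad \<eta> x) = (LINT x|?M. F x * \<eta> x)" if "\<eta> \<in> test_functions \<Omega>" for \<eta>
      unfolding P_def F_def weak_solution_test[OF \<Omega> u that] by (simp add: mult.assoc)
    obtain \<phi> where \<phi>: "\<And>j::nat. \<phi> j \<in> test_functions \<Omega>"
      "(\<lambda>j. LINT x|?M. (norm (u x - \<phi> j x))\<^sup>2) \<longlonglongrightarrow> 0"
      "(\<lambda>j. LINT x|?M. (norm (P x - grad (\<phi> j) x))\<^sup>2) \<longlonglongrightarrow> 0"
      unfolding P_def by (rule H10_approximation[OF \<Omega> uH(1)]) blast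
    have sv: "smooth_on v UNIV"
      unfolding v_def \<psi>_def power2_eq_square
      by (intro smooth_on_diff smooth_on_const smooth_on_cmult smooth_on_exp smooth_on_uminus smooth_on_mult smooth_on_inner)
    have v0: "0 \<le> v x" for x
    proof -
      have "a * \<psi> x \<le> a * 1" using \<psi>[of x] pos by (intro mult_left_mono) auto
      then show ?thesis using A by (simp add: v_def)
    qed
    have lap: "- laplacian v x = a * l x" for x
      unfolding v_def \<psi>_def l_def by (simp add: laplacian_gaussian[OF e])
    have upper: "AE x in ?M. u x \<le> v x"
    proof (rule comparison_principle[OF \<Omega> uH(3) PL FL \<phi> eqn sv v0])
      show "AE x in ?M. v x < u x \<longrightarrow> F x < - laplacian v x"
        using ub AE_space
      proof eventually_elim
        case (elim x)
        then have x: "x \<in> \<Omega>" "u x \<le> b" by auto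
        show ?case
        proof
          assume vu: "v x < u x"
          have "F x \<le> C * (K * (A - u x))"
            unfolding F_def using lam f(2) fb[OF x(2)] pos by (intro mult_mono) auto
          also have "\<dots> < C * (K * (a * \<psi> x))"
            using vu pos by (simp add: v_def)
          also have "\<dots> = a * (C * K * \<psi> x)" by simp
          also have "\<dots> < a * l x" using l[OF x(1)] pos by simp
          finally show "F x < - laplacian v x" by (simp add: lap)
        qed
      qed
    qed
    have lower: "AE x in ?M. - u x \<le> v x"
    proof (rule comparison_principle[OF \<Omega> L2_uminus[OF uH(3)] L2_uminus[OF PL] L2_uminus[OF FL]
          test_functions_uminus[OF \<phi>(1)] _ _ _ sv v0])
      show "(\<lambda>j. LINT x|?M. (norm (- u x - - \<phi> j x))\<^sup>2) \<longlonglongrightarrow> 0"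
        using \<phi>(2) by (simp add: power2_commute)
      show "(\<lambda>j. LINT x|?M. (norm (- P x - grad (\<lambda>x. - \<phi> j x) x))\<^sup>2) \<longlonglongrightarrow> 0"
        using \<phi>(3) by (simp add: grad_uminus test_functions_smooth[OF \<phi>(1)] norm_minus_commute)
      show "(LINT x|?M. - P x \<bullet> grad \<eta> x) = (LINT x|?M. - F x * \<eta> x)" if "\<eta> \<in> test_functions \<Omega>" for \<eta>
        using eqn[OF that] by simp
      show "AE x in ?M. v x < - u x \<longrightarrow> - F x < - laplacian v x"
        using AE_space
      proof eventually_elim
        case (elim x)
        then have "0 < C * K * \<psi> x" "C * K * \<psi> x < l x" using l CK \<psi> by auto
        then have "0 < a * l x" using pos by simp
        moreover have "0 \<le> F x" using lam f(2) by (simp add: F_def)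
        ultimately show ?case by (simp add: lap)
      qed
    qed
    show "AE x in ?M. \<bar>u x\<bar> \<le> A - d"
      using upper lower AE_space
    proof eventually_elim
      case (elim x)
      then show ?case using \<psi>d[of x] by (auto simp: v_def)
    qed
  qed
qed

section \<open>The nonlinearity near the limit zero\<close>

text \<open>Near \<open>a\<close> the constant comes from the monotonicity of \<open>f s + M s\<close>; away from \<open>a\<close> any bound of
  \<open>f\<close> serves, because \<open>a - s\<close> is at least \<open>\<epsilon>\<close> there.\<close>

lemma linear_bound_left_of_zero:
  fixes f :: "real \<Rightarrow> real"
  assumes cont: "continuous_on UNIV f" and nonneg: "\<And>s. 0 \<le> f s" and left: "\<And>s. s \<le> 0 \<Longrightarrow> f s = f 0"
    and a: "0 < a" "f a = 0" and M: "0 < M" "0 < \<epsilon>"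
    and mono: "mono_on {a - \<epsilon><..<a} (\<lambda>s. f s + M * s)"
  obtains K where "0 < K" "\<And>s. s \<le> a \<Longrightarrow> f s \<le> K * (a - s)"
proof -
  have "bounded (f ` {0..a})"
    by (intro compact_imp_bounded compact_continuous_image continuous_on_subset[OF cont]) auto
  then obtain B where B: "\<And>s. s \<in> {0..a} \<Longrightarrow> norm (f s) \<le> B"
    unfolding bounded_iff by blast
  have fB: "f s \<le> B" if "s \<le> a" for s
    using B[of s] B[of 0] left[of s] that a nonneg[of s] nonneg[of 0] by (cases "s \<le> 0") auto
  have B0: "0 \<le> B" using fB[of a] a by simp
  define K where "K = M + B / \<epsilon>"
  have KM: "M \<le> K" "B \<le> K * \<epsilon>" using M B0 by (auto simp: K_def field_simps)
  have "f s \<le> K * (a - s)" if s: "s \<le> a" for s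
  proof -
    consider "s = a" | "s \<le> a - \<epsilon>" | "a - \<epsilon> < s" "s < a" using s by linarith
    then show ?thesis
    proof cases
      case 1
      then show ?thesis using a by simp
    next
      case 2
      have "f s \<le> K * \<epsilon>" using fB[OF s] KM by simp
      also have "\<dots> \<le> K * (a - s)" using 2 KM M by (intro mult_left_mono) auto
      finally show ?thesis .
    next
      case 3
      \<comment> \<open>Monotonicity holds on the open interval only; letting \<open>t\<close> tend to \<open>a\<close> brings in \<open>f a = 0\<close>.\<close>
      have "isCont f a" using cont by (simp add: continuous_on_eq_continuous_at)
      then have "((\<lambda>t. f t + M * t) \<longlongrightarrow> f a + M * a) (at_left a)"
        by (intro tendsto_intros) (auto simp: isCont_def intro: filterlim_at_split[THEN iffD1, THEN conjunct1])
      moreover have "\<forall>\<^sub>F t in at_left a. f s + M * s \<le> f t + M * t"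
        using eventually_at_left_real[OF 3(2)]
        by eventually_elim (use 3 mono in \<open>auto simp: mono_on_def\<close>)
      ultimately have "f s + M * s \<le> f a + M * a"
        by (intro tendsto_lowerbound[of "\<lambda>t. f t + M * t"]) auto
      then have "f s \<le> M * (a - s)" using a by (simp add: algebra_simps)
      also have "\<dots> \<le> K * (a - s)" using KM 3 by (intro mult_right_mono) auto
      finally show ?thesis .
    qed
  qed
  moreover have "0 < K" using KM M by linarith
  ultimately show ?thesis using that by blast
qed

text \<open>The slack \<open>K \<tau>\<close> absorbs the values of \<open>f\<close> to the right of \<open>a\<close>, on which only continuity
  gives information; the slope \<open>K\<close> does not change.\<close>

lemma linear_bound_across_zero:
  fixes f :: "real \<Rightarrow> real"
  assumes cont: "continuous_on UNIV f" and a: "f a = 0" and K: "0 < K" "\<And>s. s \<le> a \<Longrightarrow> f s \<le> K * (a - s)"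
    and \<tau>: "0 < \<tau>"
  obtains \<rho> where "0 < \<rho>" "\<rho> \<le> \<tau>" "\<And>s. s \<le> a + \<rho> \<Longrightarrow> f s \<le> K * (a + \<tau> - s)"
proof -
  have "isCont f a" using cont by (simp add: continuous_on_eq_continuous_at)
  then obtain r where r: "0 < r" "\<And>s. \<bar>s - a\<bar> < r \<Longrightarrow> \<bar>f s - f a\<bar> < K * \<tau> / 2"
    using K(1) \<tau> unfolding continuous_at_eps_delta
    by (metis dist_real_def divide_pos_pos mult_pos_pos zero_less_numeral)
  define \<rho> where "\<rho> = min (r / 2) (\<tau> / 2)"
  have \<rho>: "0 < \<rho>" "\<rho> < r" "\<rho> \<le> \<tau> / 2" using r(1) \<tau> by (auto simp: \<rho>_def)
  have "f s \<le> K * (a + \<tau> - s)" if s: "s \<le> a + \<rho>" for s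
  proof (cases "s \<le> a")
    case True
    then have "f s \<le> K * (a - s)" by (rule K)
    also have "\<dots> \<le> K * (a + \<tau> - s)" using K(1) \<tau> by (intro mult_left_mono) auto
    finally show ?thesis .
  next
    case False
    then have "f s \<le> K * (\<tau> / 2)" using r(2)[of s] s \<rho> a by auto
    also have "\<dots> \<le> K * (a + \<tau> - s)" using K(1) s \<rho> by (intro mult_left_mono) auto
    finally show ?thesis .
  qed
  with that[of \<rho>] \<rho> \<tau> show ?thesis by auto
qed

theorem proposition3p1:
  fixes \<Omega> :: "'a::euclidean_space set"
    and f :: "real \<Rightarrow> real"
    and \<alpha> :: "nat \<Rightarrow> real"
    and a :: real
  assumes "open \<Omega>" and "bounded \<Omega>" and "smooth_boundary \<Omega>"
    and "continuous_on UNIV f"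
    and "\<And>s. 0 \<le> f s"
    and "\<And>s. s \<le> 0 \<Longrightarrow> f s = f 0"
    and "monoseq \<alpha>"
    and "\<And>n. 0 < \<alpha> n"
    and "\<And>n. f (\<alpha> n) = 0"
    and "\<alpha> \<longlonglongrightarrow> a"
    and "0 < a"
    and "\<And>\<sigma>. \<sigma> \<in> insert a (range \<alpha>) \<Longrightarrow>
           \<exists>M>0. \<exists>\<epsilon>>0. mono_on {\<sigma> - \<epsilon><..<\<sigma>} (\<lambda>s. f s + M * s)"
  shows "(\<lambda>n. Inf (ereal ` Lambda_set \<Omega> f (\<alpha> n) (\<alpha> (Suc n)))) \<longlonglongrightarrow> \<infinity>"
proof -
  have "isCont f a" using assms(4) by (simp add: continuous_on_eq_continuous_at)
  then have "(\<lambda>n. f (\<alpha> n)) \<longlonglongrightarrow> f a" using assms(10) by (rule isCont_tendsto_compose)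
  then have fa: "f a = 0" by (simp add: assms(9) LIMSEQ_const_iff)
  obtain M \<epsilon> where M: "0 < M" "0 < \<epsilon>" "mono_on {a - \<epsilon><..<a} (\<lambda>s. f s + M * s)"
    using assms(12)[of a] by blast
  obtain K where K: "0 < K" "\<And>s. s \<le> a \<Longrightarrow> f s \<le> K * (a - s)"
    by (rule linear_bound_left_of_zero[OF assms(4,5,6) assms(11) fa M]) blast+
  have large: "\<forall>\<^sub>F n in sequentially. \<forall>lam\<in>Lambda_set \<Omega> f (\<alpha> n) (\<alpha> (Suc n)). C < lam" if C: "0 < C" for C
  proof -
    obtain d where d: "d > 0"
      "\<And>A b lam u. a \<le> A \<Longrightarrow> b \<le> A \<Longrightarrow> 0 \<le> lam \<Longrightarrow> lam \<le> C \<Longrightarrow> weak_solution \<Omega> lam f u \<Longrightarrow>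
        AE x in lebesgue_on \<Omega>. \<bar>u x\<bar> \<le> b \<Longrightarrow> (\<And>s. s \<le> b \<Longrightarrow> f s \<le> K * (A - s)) \<Longrightarrow>
        AE x in lebesgue_on \<Omega>. \<bar>u x\<bar> \<le> A - d"
      by (rule weak_solution_bound_below_zero_level[OF assms(1,2,4,5,11) K(1) C]) blast
    obtain \<rho> where \<rho>: "0 < \<rho>" "\<rho> \<le> d / 2" "\<And>s. s \<le> a + \<rho> \<Longrightarrow> f s \<le> K * (a + d / 2 - s)"
      using linear_bound_across_zero[OF assms(4) fa K, of "d / 2"] d(1) by auto
    have near: "\<forall>\<^sub>F n in sequentially. a - d / 2 < \<alpha> n \<and> \<alpha> n < a + \<rho>"
      using order_tendstoD[OF assms(10)] \<rho>(1) d(1) by (auto intro!: eventually_conj)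
    then have "\<forall>\<^sub>F n in sequentially. a - d / 2 < \<alpha> (Suc n) \<and> \<alpha> (Suc n) < a + \<rho>"
      by (rule eventually_sequentially_Suc[THEN iffD2])
    with near show ?thesis
    proof eventually_elim
      case (elim n)
      define lo hi where "lo = min (\<alpha> n) (\<alpha> (Suc n))" and "hi = max (\<alpha> n) (\<alpha> (Suc n))"
      have lohi: "a - d / 2 < lo" "hi < a + \<rho>" "0 < lo" "0 < hi"
        using elim assms(8)[of n] assms(8)[of "Suc n"] by (auto simp: lo_def hi_def)
      show ?case
      proof (rule ballI, rule ccontr)
        fix lam assume "lam \<in> Lambda_set \<Omega> f (\<alpha> n) (\<alpha> (Suc n))" and "\<not> C < lam"
        then obtain u where lam: "0 \<le> lam" "lam \<le> C" and u: "weak_solution \<Omega> lam f u"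
          and norm: "ennreal lo < Linf_norm \<Omega> u" "Linf_norm \<Omega> u < ennreal hi"
          by (auto simp: Lambda_set_def lo_def hi_def)
        have um: "u \<in> borel_measurable (lebesgue_on \<Omega>)" using u by (auto simp: weak_solution_def Linf_def)
        have "AE x in lebesgue_on \<Omega>. ennreal \<bar>u x\<bar> \<le> Linf_norm \<Omega> u"
          unfolding Linf_norm_def by (rule esssup_AE)
        then have ub: "AE x in lebesgue_on \<Omega>. \<bar>u x\<bar> \<le> a + \<rho>"
        proof eventually_elim
          case (elim x)
          then have "ennreal \<bar>u x\<bar> \<le> ennreal hi" using norm(2) by simp
          then show ?case using lohi by simp
        qed
        have "AE x in lebesgue_on \<Omega>. \<bar>u x\<bar> \<le> (a + d / 2) - d"
          by (rule d(2)[OF _ _ lam u ub \<rho>(3)]) (use d(1) \<rho>(2) in auto)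
        then have "AE x in lebesgue_on \<Omega>. ennreal \<bar>u x\<bar> \<le> ennreal lo"
          by eventually_elim (use lohi in \<open>auto intro!: ennreal_leI\<close>)
        then have "Linf_norm \<Omega> u \<le> ennreal lo"
          unfolding Linf_norm_def using um by (intro esssup_I) auto
        then show False using norm(1) by simp
      qed
    qed
  qed
  show ?thesis
    unfolding tendsto_PInfty
  proof
    fix r :: real
    define C where "C = max 1 (r + 1)"
    have "0 < C" "r < C" by (auto simp: C_def)
    show "\<forall>\<^sub>F n in sequentially. ereal r < Inf (ereal ` Lambda_set \<Omega> f (\<alpha> n) (\<alpha> (Suc n)))"
      using large[OF \<open>0 < C\<close>]
    proof eventually_elim
      case (elim n)
      then have "ereal C \<le> Inf (ereal ` Lambda_set \<Omega> f (\<alpha> n) (\<alpha> (Suc n)))"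
        by (intro INF_greatest) (auto intro: less_imp_le)
      with \<open>r < C\<close> show ?case by (metis ereal_less_eq(3) less_ereal.simps(1) order_less_le_trans)
    qed
  qed
qed

end
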